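(* Let $A \in M_n(\mathbb{C})$ be hermitian with $\|A\| \le 1$ and $\operatorname{Tr}(A) = 0$. Then, for any real $c$ with $\frac12 \le c < 1$ such that $cn$ is an integer, there is a subset $\sigma \subset [n]$ such that $$|\sigma| = cn \qquad\text{and}\qquad \lambda_{\max}(A_{\sigma}) \leq 2\sqrt{c-c^{2}},$$ where $A_\sigma$ is the principal submatrix of $A$ of size $(1-c)n$ obtained by removing the rows and columns indexed by $\sigma$.
   Context: $[n]=\{1,\dots,n\}$. $\|\cdot\|$ is the operator norm, $\operatorname{Tr}$ is the (unnormalized) trace, and $\lambda_{\max}$ is the largest eigenvalue. *)

theory Defs
  imports
    "HOL-Analysis.L2_Norm"
    "Jordan_Normal_Form.Schur_Decomposition"
    "Jordan_Normal_Form.Spectral_Radius"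
    "Jordan_Normal_Form.DL_Submatrix"
begin

definition hermitian_mat :: "complex mat \<Rightarrow> bool" where
  "hermitian_mat A \<longleftrightarrow> mat_adjoint A = A"

definition mat_trace :: "complex mat \<Rightarrow> complex" where
  "mat_trace A = (\<Sum>i<dim_row A. A $$ (i, i))"

definition vec_l2_norm :: "complex vec \<Rightarrow> real" where
  "vec_l2_norm v = L2_set (\<lambda>i. cmod (v $ i)) {..<dim_vec v}"

definition mat_op_norm :: "complex mat \<Rightarrow> real" where
  "mat_op_norm A =
     (SUP v \<in> {v \<in> carrier_vec (dim_col A). vec_l2_norm v \<le> 1}. vec_l2_norm (A *\<^sub>v v))"

text \<open>Intended for hermitian matrices of positive dimension: all eigenvalues are then real
  and there is at least one, so the maximum is taken over a finite nonempty set
  (lemma \<open>lambda_max_hermitian\<close> below).\<close>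

definition lambda_max :: "complex mat \<Rightarrow> real" where
  "lambda_max A = Max {x. eigenvalue A (complex_of_real x)}"

text \<open>Rows and columns of a matrix of dimension \<open>n\<close> are indexed by \<open>{0..<n}\<close>.\<close>

definition remove_indices :: "'a mat \<Rightarrow> nat set \<Rightarrow> 'a mat" where
  "remove_indices A S = submatrix A ({0..<dim_row A} - S) ({0..<dim_col A} - S)"

lemma remove_indices_carrier:
  assumes "A \<in> carrier_mat n n" "S \<subseteq> {0..<n}"
  shows "remove_indices A S \<in> carrier_mat (n - card S) (n - card S)"
proof -
  have "{i. i < n \<and> i \<in> {0..<n} - S} = {0..<n} - S" by auto
  moreover have "card ({0..<n} - S) = n - card S"
    using assms(2) by (simp add: card_Diff_subset finite_subset)
  ultimately show ?thesis
    using assms(1) unfolding remove_indices_def by (intro carrier_matI) (simp_all add: dim_submatrix)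
qed

lemma mat_adjoint_index:
  assumes "A \<in> carrier_mat n m" "i < m" "j < n"
  shows "mat_adjoint A $$ (i, j) = conjugate (A $$ (j, i))"
  using assms unfolding mat_adjoint_def by (auto simp: mat_of_rows_def)

lemma hermitian_mat_iff:
  assumes "A \<in> carrier_mat n n"
  shows "hermitian_mat A \<longleftrightarrow> (\<forall>i<n. \<forall>j<n. A $$ (i, j) = cnj (A $$ (j, i)))"
proof
  assume h: "hermitian_mat A"
  show "\<forall>i<n. \<forall>j<n. A $$ (i, j) = cnj (A $$ (j, i))"
  proof (intro allI impI)
    fix i j assume ij: "i < n" "j < n"
    have "mat_adjoint A $$ (i, j) = conjugate (A $$ (j, i))"
      by (rule mat_adjoint_index[OF assms ij])
    then show "A $$ (i, j) = cnj (A $$ (j, i))"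
      using h unfolding hermitian_mat_def by (metis conjugate_complex_def)
  qed
next
  assume h: "\<forall>i<n. \<forall>j<n. A $$ (i, j) = cnj (A $$ (j, i))"
  show "hermitian_mat A" unfolding hermitian_mat_def
  proof (rule eq_matI)
    fix i j assume "i < dim_row A" "j < dim_col A"
    then have ij: "i < n" "j < n" using assms by auto
    show "mat_adjoint A $$ (i, j) = A $$ (i, j)"
      unfolding mat_adjoint_index[OF assms ij] using h ij by (metis conjugate_complex_def)
  next
    show "dim_row (mat_adjoint A) = dim_row A" "dim_col (mat_adjoint A) = dim_col A"
      using assms unfolding mat_adjoint_def by auto
  qed
qed

lemma hermitian_eigenvalue_real:
  assumes A: "A \<in> carrier_mat n n" and h: "hermitian_mat A" and e: "eigenvalue A k"
  shows "k \<in> \<real>"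
proof -
  obtain v where v: "v \<in> carrier_vec n" "v \<noteq> 0\<^sub>v n" "A *\<^sub>v v = k \<cdot>\<^sub>v v"
    using e A unfolding eigenvalue_def eigenvector_def by auto
  let ?q = "\<Sum>i<n. \<Sum>j<n. cnj (v $ i) * A $$ (i, j) * v $ j"
  let ?N = "\<Sum>i<n. (cmod (v $ i))\<^sup>2"
  have row: "(\<Sum>j<n. A $$ (i, j) * v $ j) = k * v $ i" if "i < n" for i
  proof -
    have "(A *\<^sub>v v) $ i = (\<Sum>j<n. A $$ (i, j) * v $ j)"
      using A v(1) that by (auto simp: scalar_prod_def lessThan_atLeast0 intro!: sum.cong)
    then show ?thesis using v that by simp
  qed
  have "?q = (\<Sum>i<n. cnj (v $ i) * (\<Sum>j<n. A $$ (i, j) * v $ j))"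
    by (simp add: sum_distrib_left mult.assoc)
  also have "\<dots> = (\<Sum>i<n. k * complex_of_real ((cmod (v $ i))\<^sup>2))"
  proof (rule sum.cong[OF refl])
    fix i assume "i \<in> {..<n}"
    then have i: "i < n" by simp
    show "cnj (v $ i) * (\<Sum>j<n. A $$ (i, j) * v $ j) = k * complex_of_real ((cmod (v $ i))\<^sup>2)"
      unfolding row[OF i] complex_norm_square by (simp only: mult_ac)
  qed
  finally have q: "?q = k * complex_of_real ?N" by (simp only: sum_distrib_left of_real_sum)
  have "cnj ?q = (\<Sum>i<n. \<Sum>j<n. cnj (v $ j) * A $$ (j, i) * v $ i)"
  proof -
    have "cnj (A $$ (i, j)) = A $$ (j, i)" if "i < n" "j < n" for i j
    proof -
      have "A $$ (j, i) = cnj (A $$ (i, j))"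
        using h that unfolding hermitian_mat_iff[OF A] by blast
      then show ?thesis by (rule sym)
    qed
    then show ?thesis
      unfolding cnj_sum complex_cnj_mult complex_cnj_cnj
      by (intro sum.cong[OF refl]) (simp add: mult_ac)
  qed
  also have "\<dots> = ?q" by (rule sum.swap)
  finally have "cnj ?q = ?q" .
  then have "cnj k * complex_of_real ?N = k * complex_of_real ?N" 
    unfolding q by (simp only: complex_cnj_mult complex_cnj_complex_of_real)
  moreover have "?N \<noteq> 0"
  proof
    assume "?N = 0"
    then have "v $ i = 0" if "i < n" for i
      using that by (simp add: sum_nonneg_eq_0_iff)
    then have "v = 0\<^sub>v n" using v(1) by (intro eq_vecI) auto
    then show False using v(2) by contradiction
  qed
  then have "complex_of_real ?N \<noteq> 0" by (subst of_real_eq_0_iff)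
  ultimately have "cnj k = k" by (simp only: mult_cancel_right) blast
  then show ?thesis by (simp only: Reals_cnj_iff)
qed

lemma lambda_max_hermitian:
  assumes A: "A \<in> carrier_mat n n" and "hermitian_mat A" and "0 < n"
  shows "finite {x. eigenvalue A (complex_of_real x)}"
    and "{x. eigenvalue A (complex_of_real x)} \<noteq> {}"
    and "eigenvalue A (complex_of_real (lambda_max A))"
    and "eigenvalue A k \<Longrightarrow> Re k \<le> lambda_max A"
proof -
  let ?S = "{x. eigenvalue A (complex_of_real x)}"
  have re: "complex_of_real (Re k) = k" if "eigenvalue A k" for k
    by (rule of_real_Re[OF hermitian_eigenvalue_real[OF assms(1,2) that]])
  have "?S \<subseteq> Re ` spectrum A"
  proof
    fix x assume "x \<in> ?S"
    then have "complex_of_real x \<in> spectrum A" by (simp add: spectrum_def)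
    then have "Re (complex_of_real x) \<in> Re ` spectrum A" by (rule imageI)
    then show "x \<in> Re ` spectrum A" by simp
  qed
  then show fin: "finite ?S"
    using card_finite_spectrum(1)[OF A] finite_subset by blast
  obtain l where l: "eigenvalue A l"
    using spectrum_non_empty[OF A] assms(3) unfolding spectrum_def by auto
  have "Re l \<in> ?S" using l re[OF l] by (simp only: mem_Collect_eq)
  then show ne: "?S \<noteq> {}" by blast
  show "eigenvalue A (complex_of_real (lambda_max A))"
    using Max_in[OF fin ne] unfolding lambda_max_def by simp
  show "Re k \<le> lambda_max A" if k: "eigenvalue A k"
  proof -
    have "Re k \<in> ?S" using k re[OF k] by (simp only: mem_Collect_eq)
    then show ?thesis unfolding lambda_max_def by (rule Max_ge[OF fin])
  qed
qed

lemma mat_op_norm_bdd_above: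
  "bdd_above ((\<lambda>v. vec_l2_norm (A *\<^sub>v v)) ` {v \<in> carrier_vec (dim_col A). vec_l2_norm v \<le> 1})"
proof (rule bdd_aboveI2)
  fix v assume "v \<in> {v \<in> carrier_vec (dim_col A). vec_l2_norm v \<le> 1}"
  then have d: "dim_vec v = dim_col A" and n: "vec_l2_norm v \<le> 1" by auto
  have v1: "cmod (v $ j) \<le> 1" if "j < dim_col A" for j
    using member_le_L2_set[of "{..<dim_vec v}" j "\<lambda>i. cmod (v $ i)"] n d that
    unfolding vec_l2_norm_def by simp
  have "vec_l2_norm (A *\<^sub>v v) \<le> (\<Sum>i<dim_row A. cmod ((A *\<^sub>v v) $ i))"
    unfolding vec_l2_norm_def dim_mult_mat_vec by (rule L2_set_le_sum) simp
  also have "\<dots> \<le> (\<Sum>i<dim_row A. \<Sum>j<dim_col A. cmod (A $$ (i, j)))"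
  proof (rule sum_mono)
    fix i assume i: "i \<in> {..<dim_row A}"
    have "cmod ((A *\<^sub>v v) $ i) = cmod (\<Sum>j<dim_col A. A $$ (i, j) * v $ j)"
      using i d by (auto simp: scalar_prod_def lessThan_atLeast0 intro!: arg_cong[of _ _ cmod] sum.cong)
    also have "\<dots> \<le> (\<Sum>j<dim_col A. cmod (A $$ (i, j)))"
      using v1 by (intro sum_norm_le) (auto simp: norm_mult mult_left_le)
    finally show "cmod ((A *\<^sub>v v) $ i) \<le> (\<Sum>j<dim_col A. cmod (A $$ (i, j)))" .
  qed
  finally show "vec_l2_norm (A *\<^sub>v v) \<le> (\<Sum>i<dim_row A. \<Sum>j<dim_col A. cmod (A $$ (i, j)))" .
qed

end

theory Submission
  imports Defs
begin

text \<open>Let \<open>p\<close> be the characteristic polynomial of \<open>A\<close> and \<open>k = c n\<close>. The characteristic polynomials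
  of the principal submatrices obtained by deleting one index sum to \<open>p'\<close> and interlace \<open>p\<close>, and
  interlacing survives differentiation. Hence indices can be deleted one at a time so that the
  largest eigenvalue of the final submatrix is at most the largest root of the \<open>k\<close>-th derivative of
  \<open>p\<close>.

  Moving two roots of \<open>p\<close> apart while keeping their sum fixed does not decrease the largest root of
  the \<open>k\<close>-th derivative. Since the roots lie in \<open>[-1, 1]\<close> and have sum \<open>0\<close>, this leaves
  \<open>p = (x^2 - 1)^N\<close> and \<open>p = x (x^2 - 1)^N\<close>; the latter is a multiple of the derivative of
  \<open>(x^2 - 1)^(N + 1)\<close>. The derivatives of \<open>(x^2 - 1)^N\<close> solve Gegenbauer's differential equation,
  which together with the Laguerre inequality \<open>q'^2 \<ge> q q''\<close> bounds the largest root.\<close>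

subsection \<open>Interlacing polynomials\<close>

interpretation of_real_poly_hom: map_poly_inj_idom_hom "of_real :: real \<Rightarrow> complex" ..

definition uhp_free :: "complex poly \<Rightarrow> bool" where
  "uhp_free H \<longleftrightarrow> (\<forall>z. Im z > 0 \<longrightarrow> poly H z \<noteq> 0)"

text \<open>By the Hermite--Biehler theorem this says that the real-rooted \<open>G\<close> and \<open>F\<close> interlace,
  with the sign for which \<open>G / F\<close> is decreasing. Stated without roots, it is inherited by
  derivatives through the half-plane version of Gauss--Lucas.\<close>

definition interlaces :: "real poly \<Rightarrow> real poly \<Rightarrow> bool" where
  "interlaces G F \<longleftrightarrow> uhp_free (map_poly of_real F + Polynomial.smult \<i> (map_poly of_real G))"

lemma Im_inverse_diff:
  fixes w a :: complex
  shows "Im a \<le> Im w \<Longrightarrow> Im (1 / (w - a)) \<le> 0"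
    and "Im a < Im w \<Longrightarrow> Im (1 / (w - a)) < 0"
proof -
  have e: "Im (1 / (w - a)) = - (Im w - Im a) / (cmod (w - a))\<^sup>2"
    by (simp add: Im_divide cmod_power2 diff_divide_distrib)
  show "Im a \<le> Im w \<Longrightarrow> Im (1 / (w - a)) \<le> 0"
    unfolding e by (intro divide_nonpos_nonneg) auto
  assume l: "Im a < Im w"
  then have "w - a \<noteq> 0" by auto
  with l show "Im (1 / (w - a)) < 0"
    unfolding e by (intro divide_neg_pos) auto
qed

lemma Im_log_pderiv_prod:
  fixes M :: "complex multiset"
  assumes "\<forall>a\<in>#M. Im a \<le> 0" and "Im w \<ge> 0" and "poly (\<Prod>a\<in>#M. [:-a, 1:]) w \<noteq> 0"
  shows "Im (poly (pderiv (\<Prod>a\<in>#M. [:-a, 1:])) w / poly (\<Prod>a\<in>#M. [:-a, 1:]) w) \<le> 0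
    \<and> (Im w > 0 \<and> M \<noteq> {#} \<longrightarrow>
        Im (poly (pderiv (\<Prod>a\<in>#M. [:-a, 1:])) w / poly (\<Prod>a\<in>#M. [:-a, 1:]) w) < 0)"
  using assms
proof (induction M)
  case empty
  then show ?case by simp
next
  case (add a M)
  let ?P = "\<Prod>a\<in>#M. [:-a, 1:]"
  have nz: "w - a \<noteq> 0" "poly ?P w \<noteq> 0" using add.prems(3) by auto
  have "poly (pderiv (\<Prod>a\<in>#add_mset a M. [:-a, 1:])) w / poly (\<Prod>a\<in>#add_mset a M. [:-a, 1:]) w
      = poly (pderiv ([:-a, 1:] * ?P)) w / poly ([:-a, 1:] * ?P) w" by simp
  also have "\<dots> = 1 / (w - a) + poly (pderiv ?P) w / poly ?P w"
    using nz unfolding pderiv_mult by (simp add: pderiv_pCons field_simps)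
  finally have e: "poly (pderiv (\<Prod>a\<in>#add_mset a M. [:-a, 1:])) w / poly (\<Prod>a\<in>#add_mset a M. [:-a, 1:]) w
      = 1 / (w - a) + poly (pderiv ?P) w / poly ?P w" .
  have IH: "Im (poly (pderiv ?P) w / poly ?P w) \<le> 0" using add nz by auto
  have a: "Im (1 / (w - a)) \<le> 0" "Im w > 0 \<Longrightarrow> Im (1 / (w - a)) < 0"
    using Im_inverse_diff[of a w] add.prems by auto
  show ?case unfolding e plus_complex.sel using IH a by auto
qed

lemma Im_log_pderiv:
  assumes "uhp_free H" and "Im w \<ge> 0" and "poly H w \<noteq> 0"
  shows "Im (poly (pderiv H) w / poly H w) \<le> 0"
    and "Im w > 0 \<Longrightarrow> degree H > 0 \<Longrightarrow> Im (poly (pderiv H) w / poly H w) < 0"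
proof -
  have H0: "H \<noteq> 0" using assms by auto
  from alg_closed_imp_factorization[OF H0] obtain M where M: "size M = degree H"
    "H = Polynomial.smult (lead_coeff H) (\<Prod>a\<in>#M. [:-a, 1:])" by auto
  define c where "c = lead_coeff H"
  have c: "c \<noteq> 0" using H0 c_def by simp
  let ?P = "\<Prod>a\<in>#M. [:-a, 1:]"
  have H: "H = Polynomial.smult c ?P" using M c_def by simp
  have im: "\<forall>a\<in>#M. Im a \<le> 0"
  proof
    fix a assume "a \<in># M"
    then have "poly ?P a = 0" by (auto dest!: multi_member_split)
    then have "poly H a = 0" unfolding H by simp
    then show "Im a \<le> 0" using assms(1) unfolding uhp_free_def by (meson not_le)
  qed
  have P0: "poly ?P w \<noteq> 0" using assms(3) unfolding H by auto
  have e: "poly (pderiv H) w / poly H w = poly (pderiv ?P) w / poly ?P w"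
    unfolding H pderiv_smult using c by simp
  note * = Im_log_pderiv_prod[OF im assms(2) P0]
  show "Im (poly (pderiv H) w / poly H w) \<le> 0" unfolding e using * by blast
  show "Im w > 0 \<Longrightarrow> degree H > 0 \<Longrightarrow> Im (poly (pderiv H) w / poly H w) < 0"
    unfolding e using * M(1) by auto
qed

text \<open>At a zero of \<open>pderiv H\<close> in the upper half-plane the logarithmic derivative
  would vanish, while its imaginary part is strictly negative there.\<close>

lemma uhp_free_pderiv:
  assumes "uhp_free H" and "pderiv H \<noteq> 0"
  shows "uhp_free (pderiv H)"
  unfolding uhp_free_def
proof (intro allI impI notI)
  fix z assume z: "Im z > 0" "poly (pderiv H) z = 0"
  have "degree H > 0" using assms(2) by (simp add: pderiv_eq_0_iff)
  moreover have "poly H z \<noteq> 0" using assms(1) z unfolding uhp_free_def by auto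
  ultimately show False using Im_log_pderiv(2)[OF assms(1), of z] z by auto
qed

lemma interlaces_higher_pderiv:
  assumes "interlaces G F" and "(pderiv ^^ j) F \<noteq> 0"
  shows "interlaces ((pderiv ^^ j) G) ((pderiv ^^ j) F)"
  using assms(2)
proof (induction j)
  case 0
  then show ?case using assms(1) by simp
next
  case (Suc j)
  let ?F = "(pderiv ^^ j) F" and ?G = "(pderiv ^^ j) G"
  let ?H = "map_poly of_real ?F + Polynomial.smult \<i> (map_poly of_real ?G)"
  have nz: "pderiv ?F \<noteq> 0" using Suc.prems by simp
  then have "?F \<noteq> 0" by (metis pderiv_0)
  with Suc.IH have H: "uhp_free ?H" by (simp add: interlaces_def)
  have d: "pderiv ?H = map_poly of_real (pderiv ?F) + Polynomial.smult \<i> (map_poly of_real (pderiv ?G))"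
    by (simp add: pderiv_add pderiv_smult of_real_hom.map_poly_pderiv)
  \<comment> \<open>\<open>?F\<close> and \<open>?G\<close> are real, so the real parts of the
    coefficients of \<open>pderiv ?H\<close> are the coefficients of \<open>pderiv ?F\<close>; the
    two summands cannot cancel.\<close>
  have "pderiv ?H \<noteq> 0"
  proof
    assume "pderiv ?H = 0"
    then have "coeff (map_poly of_real (pderiv ?F) + Polynomial.smult \<i> (map_poly of_real (pderiv ?G))) m = 0" for m
      unfolding d by simp
    then have "Re (complex_of_real (coeff (pderiv ?F) m) + \<i> * complex_of_real (coeff (pderiv ?G) m)) = 0" for m
      by (simp del: Re_complex_of_real plus_complex.sel)
    then have "coeff (pderiv ?F) m = 0" for m by simp
    then show False using nz by (simp add: poly_eq_iff)
  qed
  from uhp_free_pderiv[OF H this] show ?case unfolding d interlaces_def by simp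
qed

text \<open>At a real point, \<open>Im (H' / H)\<close> for \<open>H = F + i G\<close> has the sign
  of \<open>F G' - F' G\<close>. Where \<open>H\<close> vanishes, so do \<open>F\<close> and
  \<open>G\<close>, and both sides are zero.\<close>

lemma interlaces_wronskian:
  assumes "interlaces G F"
  shows "poly F x * poly (pderiv G) x \<le> poly (pderiv F) x * poly G x"
proof -
  let ?H = "map_poly of_real F + Polynomial.smult \<i> (map_poly of_real G)"
  let ?a = "poly F x" and ?b = "poly G x" and ?c = "poly (pderiv F) x" and ?d = "poly (pderiv G) x"
  have H: "poly ?H (of_real x) = Complex ?a ?b"
    by (simp add: complex_eq_iff of_real_hom.poly_map_poly)
  have D: "poly (pderiv ?H) (of_real x) = Complex ?c ?d"
    by (simp add: complex_eq_iff pderiv_add pderiv_smult of_real_hom.poly_map_poly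
        flip: of_real_hom.map_poly_pderiv)
  show ?thesis
  proof (cases "Complex ?a ?b = 0")
    case True
    then show ?thesis by (simp add: complex_eq_iff)
  next
    case False
    have "Im (Complex ?c ?d / Complex ?a ?b) \<le> 0"
      using Im_log_pderiv(1)[OF assms[unfolded interlaces_def], of "of_real x"] False
      unfolding H D by simp
    moreover have "?a\<^sup>2 + ?b\<^sup>2 > 0"
      using False by (simp add: complex_eq_iff sum_power2_gt_zero_iff)
    ultimately show ?thesis by (simp add: Im_divide divide_le_0_iff mult.commute)
  qed
qed

section \<open>Sign consequences of interlacing\<close>

lemma interlaces_ratio_antimono:
  fixes F G :: "real poly"
  assumes "interlaces G F" and "x \<le> y" and "\<And>t. x \<le> t \<Longrightarrow> t \<le> y \<Longrightarrow> poly F t \<noteq> 0"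
  shows "poly G y / poly F y \<le> poly G x / poly F x"
proof (rule DERIV_nonpos_imp_nonincreasing[OF assms(2)])
  fix t assume t: "x \<le> t" "t \<le> y"
  have "((\<lambda>x. poly G x / poly F x) has_real_derivative
     (poly (pderiv G) t * poly F t - poly G t * poly (pderiv F) t) / (poly F t * poly F t)) (at t)"
    using assms(3)[OF t] by (intro DERIV_divide poly_DERIV) auto
  moreover have "(poly (pderiv G) t * poly F t - poly G t * poly (pderiv F) t) / (poly F t * poly F t) \<le> 0"
    using interlaces_wronskian[OF assms(1), of t] by (intro divide_nonpos_nonneg) (auto simp: mult.commute)
  ultimately show "\<exists>y. ((\<lambda>x. poly G x / poly F x) has_real_derivative y) (at t) \<and> y \<le> 0" by blast
qed

text \<open>The ratio \<open>G / F\<close> decreases to its limit 0, so it is nonnegative on the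
  whole ray. If it were not positive at \<open>x\<close>, it would vanish on the ray, which is
  impossible for a nonzero polynomial.\<close>

lemma interlaces_pos:
  fixes F G :: "real poly"
  assumes "interlaces G F" and "degree G < degree F" and "G \<noteq> 0" and F: "\<And>t. x \<le> t \<Longrightarrow> poly F t > 0"
  shows "poly G x > 0"
proof (rule ccontr)
  assume "\<not> poly G x > 0"
  then have hx: "poly G x / poly F x \<le> 0" using F[of x] by (intro divide_nonpos_pos) auto
  have lim: "((\<lambda>t. poly G t / poly F t) \<longlongrightarrow> 0) at_top"
    using poly_divide_tendsto_0_at_infinity[OF assms(2)] at_top_le_at_infinity
    by (rule tendsto_mono[rotated])
  have "poly G y = 0" if "x \<le> y" for y
  proof -
    have anti: "poly G t / poly F t \<le> poly G s / poly F s" if st: "x \<le> s" "s \<le> t" for s t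
    proof (rule interlaces_ratio_antimono[OF assms(1) st(2)])
      fix r assume "s \<le> r" "r \<le> t"
      then show "poly F r \<noteq> 0" using F[of r] st by simp
    qed
    have "eventually (\<lambda>t. poly G t / poly F t \<le> poly G y / poly F y) at_top"
      using eventually_ge_at_top[of y] by eventually_elim (use anti that in auto)
    then have "0 \<le> poly G y / poly F y"
      by (intro tendsto_upperbound[OF lim]) auto
    moreover have "poly G y / poly F y \<le> 0" using anti[of x y] that hx by simp
    ultimately have "poly G y / poly F y = 0" by linarith
    then show ?thesis using F[OF that] by simp
  qed
  then have "{x..} \<subseteq> {y. poly G y = 0}" by auto
  moreover have "finite {y. poly G y = 0}" using assms(3) by (rule poly_roots_finite)
  ultimately show False using infinite_Ici[of x] finite_subset by blast
qed

text \<open>Beyond \<open>b\<close> the polynomial \<open>F\<close> increases, and it cannot be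
  positive at \<open>x\<close>, since \<open>interlaces_pos\<close> would then make \<open>G\<close>
  positive there. Hence \<open>F < 0\<close> to the left of \<open>x\<close>, where the decreasing
  ratio \<open>G / F\<close> carries the sign of \<open>G\<close> back to \<open>y\<close>. The
  delicate case is a common zero of \<open>F\<close> and \<open>G\<close> at
  \<open>x\<close>.\<close>

lemma interlaces_nonpos_left:
  fixes F G :: "real poly"
  assumes I: "interlaces G F" and deg: "degree G < degree F" and G: "G \<noteq> 0"
    and F': "\<And>t. b < t \<Longrightarrow> poly (pderiv F) t > 0"
    and x: "b < x" "poly G x \<le> 0" and y: "b < y" "y \<le> x"
  shows "poly G y \<le> 0"
proof -
  have mono: "poly F s < poly F t" if "b < s" "s < t" for s t
    by (rule DERIV_pos_imp_increasing[OF that(2)]) (use F' that in \<open>force intro: poly_DERIV\<close>)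
  have Fx: "poly F x \<le> 0"
  proof (rule ccontr)
    assume "\<not> poly F x \<le> 0"
    then have "poly F t > 0" if "x \<le> t" for t using mono[of x t] x that by (cases "t = x") auto
    then show False using interlaces_pos[OF I deg G, of x] x by auto
  qed
  show ?thesis
  proof (cases "y = x")
    case False
    then have yx: "y < x" using y by simp
    have Fneg: "poly F t < 0" if "b < t" "t < x" for t using mono[OF that] Fx by simp
    show ?thesis
    proof (cases "poly F x = 0")
      case False
      then have "poly F t \<noteq> 0" if "y \<le> t" "t \<le> x" for t
        using Fneg[of t] that y by (cases "t = x") auto
      then have "poly G x / poly F x \<le> poly G y / poly F y"
        using interlaces_ratio_antimono[OF I y(2)] by simp
      moreover have "0 \<le> poly G x / poly F x" using x Fx by (intro divide_nonpos_nonpos) auto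
      ultimately have "0 \<le> poly G y / poly F y" by linarith
      then show ?thesis using Fneg[OF y(1) yx] by (simp add: zero_le_divide_iff)
    next
      case True
      have Gx: "poly G x = 0"
        using interlaces_wronskian[OF I, of x] F'[OF x(1)] x(2) True by (simp add: zero_le_mult_iff)
      show ?thesis
      proof (rule ccontr)
        assume "\<not> poly G y \<le> 0"
        then have Gy: "poly G y > 0" by simp
        \<comment> \<open>If \<open>G\<close> is positive at \<open>y\<close>, the ratio stays at
          most \<open>- d\<close> up to \<open>x\<close>, so \<open>?K = G + d F\<close> is
          nonnegative on \<open>[y, x)\<close> and vanishes at \<open>x\<close>. Its slope at
          \<open>x\<close> is then at most 0, and \<open>F' > 0\<close> forces
          \<open>G' < 0\<close>.\<close>
        define d where "d = - (poly G y / poly F y)"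
        have d: "d > 0" unfolding d_def using Gy Fneg[OF y(1) yx] by (simp add: divide_pos_neg)
        let ?K = "G + Polynomial.smult d F"
        have K: "poly ?K t \<ge> 0" if "y \<le> t" "t < x" for t
        proof -
          have "poly F s \<noteq> 0" if "y \<le> s" "s \<le> t" for s
            using Fneg[of s] that y \<open>t < x\<close> by force
          then have "poly G t / poly F t \<le> - d"
            using interlaces_ratio_antimono[OF I that(1)] by (simp add: d_def)
          then show ?thesis using Fneg[of t] that y by (simp add: divide_le_eq split: if_splits)
        qed
        \<comment> \<open>\<open>F\<close> and \<open>G\<close> have the common zero \<open>x\<close>, but \<open>G\<close> cannot cross zero downwards there,
          since it is positive to the right of \<open>x\<close>.\<close>
        have Gd: "poly (pderiv G) x < 0"
        proof (rule ccontr)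
          assume "\<not> poly (pderiv G) x < 0"
          then have "poly (pderiv ?K) x > 0"
            using d F'[OF x(1)] by (simp add: pderiv_add pderiv_smult add_nonneg_pos)
          from DERIV_pos_inc_left[OF poly_DERIV this] obtain e where e: "e > 0"
            "\<And>h. 0 < h \<Longrightarrow> h < e \<Longrightarrow> poly ?K (x - h) < poly ?K x" by auto
          define h where "h = min (e / 2) (x - y)"
          have "0 < h" "h < e" "y \<le> x - h" "x - h < x"
            using e(1) yx unfolding h_def by (auto simp: min_def)
          moreover have "poly ?K x = 0" using Gx True by simp
          ultimately show False using e(2)[of h] K[of "x - h"] by simp
        qed
        from DERIV_neg_dec_right[OF poly_DERIV this] obtain e where e: "e > 0"
            "\<And>h. 0 < h \<Longrightarrow> h < e \<Longrightarrow> poly G (x + h) < poly G x" by auto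
        have "poly F t > 0" if "x + e / 2 \<le> t" for t using mono[of x t] True x e(1) that by simp
        then have "poly G (x + e / 2) > 0" using interlaces_pos[OF I deg G] by blast
        then show False using e(2)[of "e / 2"] e(1) Gx by simp
      qed
    qed
  qed (use x in simp)
qed

text \<open>If every \<open>G i\<close> failed, each would be nonpositive somewhere beyond
  \<open>b\<close>, hence by \<open>interlaces_nonpos_left\<close> at one common point
  \<open>y\<close>; the sum \<open>pderiv F\<close> would then be nonpositive at
  \<open>y\<close>.\<close>

lemma exists_interlaces_pos:
  fixes F :: "real poly" and G :: "'i \<Rightarrow> real poly"
  assumes "finite I" and I: "\<And>i. i \<in> I \<Longrightarrow> interlaces (G i) F"
    and deg: "\<And>i. i \<in> I \<Longrightarrow> degree (G i) < degree F" and nz: "\<And>i. i \<in> I \<Longrightarrow> G i \<noteq> 0"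
    and F': "pderiv F = (\<Sum>i\<in>I. G i)" and pos: "\<And>t. b < t \<Longrightarrow> poly (pderiv F) t > 0"
  shows "\<exists>i\<in>I. \<forall>t>b. poly (G i) t > 0"
proof (rule ccontr)
  assume "\<not> ?thesis"
  then have "\<forall>i\<in>I. \<exists>t>b. poly (G i) t \<le> 0" by (meson not_le)
  then obtain x where x: "\<And>i. i \<in> I \<Longrightarrow> b < x i" "\<And>i. i \<in> I \<Longrightarrow> poly (G i) (x i) \<le> 0" by metis
  \<comment> \<open>The extra element \<open>b + 1\<close> keeps the minimum defined for empty
    \<open>I\<close>.\<close>
  define y where "y = Min (insert (b + 1) (x ` I))"
  have y: "b < y" "\<And>i. i \<in> I \<Longrightarrow> y \<le> x i"
    unfolding y_def using assms(1) x(1) by auto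
  have "poly (G i) y \<le> 0" if "i \<in> I" for i
    using interlaces_nonpos_left[OF I deg nz pos x y(1) y(2)] that by blast
  then have "poly (pderiv F) y \<le> 0" unfolding F' poly_sum by (rule sum_nonpos)
  then show False using pos[OF y(1)] by simp
qed

subsection \<open>Roots of higher derivatives\<close>

abbreviation root_poly :: "real multiset \<Rightarrow> real poly" where
  "root_poly M \<equiv> (\<Prod>a\<in>#M. [:-a, 1:])"

lemma degree_root_poly: "degree (root_poly M) = size M" and root_poly_nonzero: "root_poly M \<noteq> 0"
proof -
  have "root_poly M \<noteq> 0 \<and> degree (root_poly M) = size M"
  proof (induction M)
    case (add a M)
    then have "degree ([:-a, 1:] * root_poly M) = Suc (size M)" by (subst degree_mult_eq) auto
    then show ?case using add by auto
  qed auto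
  then show "degree (root_poly M) = size M" "root_poly M \<noteq> 0" by auto
qed

lemma uhp_free_mult: "uhp_free P \<Longrightarrow> uhp_free Q \<Longrightarrow> uhp_free (P * Q)"
  by (simp add: uhp_free_def)

lemma map_poly_root_poly_add:
  "map_poly of_real (root_poly (add_mset a M)) = [:- complex_of_real a, 1:] * map_poly of_real (root_poly M)"
proof -
  have "map_poly of_real [:-a, 1:] = [:- complex_of_real a, 1:]" by simp
  then show ?thesis by (simp only: image_mset_add_mset prod_mset.add_mset of_real_poly_hom.hom_mult)
qed

lemma uhp_free_root_poly: "uhp_free (map_poly of_real (root_poly M))"
proof (induction M)
  case (add a M)
  have "uhp_free [:- complex_of_real a, 1:]"
    by (auto simp: uhp_free_def complex_eq_iff)
  then have "uhp_free ([:- complex_of_real a, 1:] * map_poly of_real (root_poly M))"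
    using add by (rule uhp_free_mult)
  then show ?case by (simp only: map_poly_root_poly_add)
qed (simp add: uhp_free_def)

text \<open>The combination \<open>F + i G\<close> factors as \<open>x - a + i\<close> times
  \<open>root_poly M\<close>, and the root \<open>a - i\<close> lies in the lower
  half-plane.\<close>

lemma interlaces_remove_root: "interlaces (root_poly M) (root_poly (add_mset a M))"
proof -
  let ?P = "map_poly complex_of_real (root_poly M)"
  have "map_poly of_real (root_poly (add_mset a M)) + Polynomial.smult \<i> ?P
      = [:\<i> - complex_of_real a, 1:] * ?P"
    unfolding map_poly_root_poly_add by (simp add: smult_diff_left)
  moreover have "uhp_free [:\<i> - complex_of_real a, 1:]"
    by (auto simp: uhp_free_def complex_eq_iff)
  ultimately show ?thesis
    unfolding interlaces_def using uhp_free_mult uhp_free_root_poly by metis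
qed

text \<open>A zero of \<open>P + i P'\<close> in the upper half-plane would give
  \<open>P' / P = i\<close>, against the sign of the logarithmic derivative. The Wronskian
  inequality of this pair is the Laguerre inequality.\<close>

lemma interlaces_pderiv_self:
  assumes "uhp_free (map_poly of_real P)"
  shows "interlaces (pderiv P) P"
  unfolding interlaces_def uhp_free_def
proof (intro allI impI notI)
  fix z assume z: "Im z > 0"
    "poly (map_poly of_real P + Polynomial.smult \<i> (map_poly of_real (pderiv P))) z = 0"
  let ?H = "map_poly complex_of_real P"
  have nz: "poly ?H z \<noteq> 0" using assms z(1) unfolding uhp_free_def by auto
  have "poly ?H z + \<i> * poly (pderiv ?H) z = 0" using z(2) by (simp add: of_real_hom.map_poly_pderiv)
  then have "1 + \<i> * (poly (pderiv ?H) z / poly ?H z) = 0" using nz by (simp add: field_simps)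
  then have "Im (poly (pderiv ?H) z / poly ?H z) = 1"
    by (simp add: complex_eq_iff del: times_divide_eq_right)
  then show False using Im_log_pderiv(1)[OF assms _ nz] z(1) by simp
qed

section \<open>Removing and spreading roots\<close>

lemma higher_pderiv_eq_0:
  fixes p :: "real poly"
  assumes "degree p < k"
  shows "(pderiv ^^ k) p = 0"
  by (intro poly_eqI) (use assms in \<open>simp add: coeff_higher_pderiv coeff_eq_0\<close>)

text \<open>The polynomials with and without the root interlace, and so do their \<open>k\<close>-th
  derivatives, so \<open>interlaces_pos\<close> transfers positivity. The first alternative covers
  \<open>k\<close> above the smaller degree.\<close>

lemma higher_pderiv_remove_root:
  assumes "\<And>x. b < x \<Longrightarrow> poly ((pderiv ^^ k) (root_poly (add_mset a M))) x > 0"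
  shows "(pderiv ^^ k) (root_poly M) = 0 \<or> (\<forall>x>b. poly ((pderiv ^^ k) (root_poly M)) x > 0)"
proof (cases "(pderiv ^^ k) (root_poly M) = 0")
  case False
  then have k: "k \<le> size M" using higher_pderiv_eq_0[of "root_poly M" k] degree_root_poly not_le by metis
  have "(pderiv ^^ k) (root_poly (add_mset a M)) \<noteq> 0" using assms[of "b + 1"] by (metis less_add_one less_irrefl poly_0)
  then have I: "interlaces ((pderiv ^^ k) (root_poly M)) ((pderiv ^^ k) (root_poly (add_mset a M)))"
    by (rule interlaces_higher_pderiv[OF interlaces_remove_root])
  have "degree ((pderiv ^^ k) (root_poly M)) < degree ((pderiv ^^ k) (root_poly (add_mset a M)))"
    using k unfolding degree_higher_pderiv degree_root_poly by simp
  then show ?thesis using interlaces_pos[OF I _ False] assms by force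
qed simp

text \<open>Spreading two roots with fixed sum subtracts a nonnegative multiple of the product \<open>g\<close> of the
  remaining factors, and the \<open>k\<close>-th derivative of \<open>g\<close> is nonnegative beyond \<open>b\<close>.\<close>

lemma higher_pderiv_spread_roots:
  assumes "a + c = a' + c'" and "a' * c' \<le> a * c"
    and pos: "\<And>x. b < x \<Longrightarrow> poly ((pderiv ^^ k) (root_poly (add_mset a' (add_mset c' M)))) x > 0"
    and x: "b < x"
  shows "poly ((pderiv ^^ k) (root_poly (add_mset a (add_mset c M)))) x > 0"
proof -
  let ?g = "root_poly M"
  \<comment> \<open>The roots \<open>a'\<close> and \<open>c'\<close> are removed in turn. If the
    derivative already vanishes after the first removal, \<open>k\<close> exceeds that degree and
    the derivative of \<open>?g\<close> vanishes as well.\<close>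
  have "(pderiv ^^ k) (root_poly (add_mset c' M)) = 0 \<or>
      (\<forall>x>b. poly ((pderiv ^^ k) (root_poly (add_mset c' M))) x > 0)"
    using pos by (rule higher_pderiv_remove_root)
  then have g: "poly ((pderiv ^^ k) ?g) x \<ge> 0"
  proof
    assume 0: "(pderiv ^^ k) (root_poly (add_mset c' M)) = 0"
    have "size (add_mset c' M) < k"
    proof (rule ccontr)
      define C where "C = add_mset c' M"
      assume "\<not> size (add_mset c' M) < k"
      then have "size C - k + k = size C" unfolding C_def by simp
      moreover have "coeff (root_poly C) (size C) \<noteq> 0"
        using root_poly_nonzero[of C] degree_root_poly[of C] leading_coeff_neq_0 by metis
      ultimately have "coeff ((pderiv ^^ k) (root_poly C)) (size C - k) \<noteq> 0"
        unfolding coeff_higher_pderiv by (simp add: pochhammer_eq_0_iff)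
      then show False using 0 C_def by simp
    qed
    then have "(pderiv ^^ k) ?g = 0" by (intro higher_pderiv_eq_0) (simp add: degree_root_poly)
    then show ?thesis by simp
  next
    assume "\<forall>x>b. poly ((pderiv ^^ k) (root_poly (add_mset c' M))) x > 0"
    then have "(pderiv ^^ k) ?g = 0 \<or> (\<forall>x>b. poly ((pderiv ^^ k) ?g) x > 0)"
      by (intro higher_pderiv_remove_root[of b k c' M]) blast
    then show ?thesis using x by (auto simp: less_imp_le)
  qed
  have "[:-a, 1:] * ([:-c, 1:] * ?g) = [:-a', 1:] * ([:-c', 1:] * ?g) + Polynomial.smult (a * c - a' * c') ?g"
  proof -
    have "[:-a, 1:] * [:-c, 1:] = [:-a', 1:] * [:-c', 1:] + [:a * c - a' * c':]"
      using assms(1) by (simp add: algebra_simps)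
    from arg_cong[OF this, of "\<lambda>u. u * ?g"] show ?thesis by (simp only: mult.assoc distrib_right) simp
  qed
  then have "root_poly (add_mset a (add_mset c M)) =
      root_poly (add_mset a' (add_mset c' M)) + Polynomial.smult (a * c - a' * c') ?g"
    by (simp only: image_mset_add_mset prod_mset.add_mset)
  then have "poly ((pderiv ^^ k) (root_poly (add_mset a (add_mset c M)))) x =
      poly ((pderiv ^^ k) (root_poly (add_mset a' (add_mset c' M)))) x
      + (a * c - a' * c') * poly ((pderiv ^^ k) ?g) x"
    by (simp only: higher_pderiv_add higher_pderiv_smult poly_add poly_smult)
  then show ?thesis using pos[OF x] g assms(2) by (simp add: add_pos_nonneg)
qed

text \<open>Induction on the number of roots strictly inside \<open>(-1, 1)\<close>: as long as
  there are two, they are spread until one reaches an endpoint, which lowers the count. Positivity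
  passes from the spread roots back to the original ones.\<close>

lemma higher_pderiv_pos_reduction:
  assumes "\<forall>a\<in>#M. \<bar>a\<bar> \<le> 1"
    and "\<And>M' x. size M' = size M \<Longrightarrow> sum_mset M' = sum_mset M \<Longrightarrow> \<forall>a\<in>#M'. \<bar>a\<bar> \<le> 1 \<Longrightarrow>
      size {#a \<in># M'. \<bar>a\<bar> < 1#} \<le> 1 \<Longrightarrow> b < x \<Longrightarrow> poly ((pderiv ^^ k) (root_poly M')) x > 0"
  shows "\<forall>x>b. poly ((pderiv ^^ k) (root_poly M)) x > 0"
  using assms
proof (induction "size {#a \<in># M. \<bar>a\<bar> < 1#}" arbitrary: M rule: less_induct)
  case less
  show ?case
  proof (cases "size {#a \<in># M. \<bar>a\<bar> < 1#} \<le> 1")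
    case True
    then show ?thesis using less.prems by blast
  next
    case False
    then obtain a R where R: "{#a \<in># M. \<bar>a\<bar> < 1#} = add_mset a R" "R \<noteq> {#}"
      by (metis One_nat_def le_refl multiset_cases size_empty size_single bot_nat_0.extremum)
    then obtain c R' where R': "{#a \<in># M. \<bar>a\<bar> < 1#} = add_mset a (add_mset c R')"
      by (metis multiset_cases)
    then have "a \<in># {#a \<in># M. \<bar>a\<bar> < 1#}" "c \<in># {#a \<in># M. \<bar>a\<bar> < 1#}" by auto
    then have ac: "\<bar>a\<bar> < 1" "\<bar>c\<bar> < 1" by auto
    have "add_mset a (add_mset c R') \<subseteq># M" using R' multiset_filter_subset by metis
    then obtain Q where M0: "M = add_mset a (add_mset c R') + Q" by (metis mset_subset_eq_exists_conv)
    define Q' where "Q' = R' + Q"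
    have M: "M = add_mset a (add_mset c Q')" using M0 Q'_def by simp
    \<comment> \<open>The pair moves apart until the nearer endpoint is hit: \<open>-1\<close> if
      the sum is nonpositive, \<open>1\<close> otherwise. The product inequality is
      \<open>(1 + a) (1 + c) \<ge> 0\<close> or \<open>(1 - a) (1 - c) \<ge> 0\<close>.\<close>
    have "\<exists>a' c'. a' + c' = a + c \<and> a' * c' \<le> a * c \<and> \<bar>a'\<bar> \<le> 1 \<and> \<bar>c'\<bar> \<le> 1 \<and> (\<bar>a'\<bar> = 1 \<or> \<bar>c'\<bar> = 1)"
    proof (cases "a + c \<le> 0")
      case True
      have "(-1) * (a + c + 1) \<le> a * c" using ac mult_nonneg_nonneg[of "a + 1" "c + 1"] by (simp add: algebra_simps abs_less_iff)
      then show ?thesis using True ac by (intro exI[of _ "-1"] exI[of _ "a + c + 1"]) auto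
    next
      case False
      have "1 * (a + c - 1) \<le> a * c" using ac mult_nonneg_nonneg[of "1 - a" "1 - c"] by (simp add: algebra_simps abs_less_iff)
      then show ?thesis using False ac by (intro exI[of _ "1"] exI[of _ "a + c - 1"]) auto
    qed
    then obtain a' c' where ac': "a' + c' = a + c" "a' * c' \<le> a * c" "\<bar>a'\<bar> \<le> 1" "\<bar>c'\<bar> \<le> 1" "\<bar>a'\<bar> = 1 \<or> \<bar>c'\<bar> = 1"
      by blast
    let ?M' = "add_mset a' (add_mset c' Q')"
    have "\<forall>x>b. poly ((pderiv ^^ k) (root_poly ?M')) x > 0"
    proof (rule less.hyps)
      show "size {#a \<in># ?M'. \<bar>a\<bar> < 1#} < size {#a \<in># M. \<bar>a\<bar> < 1#}" unfolding M using ac ac'(5) by auto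
      show "\<forall>a\<in>#?M'. \<bar>a\<bar> \<le> 1" using less.prems(1) ac' unfolding M by auto
      fix M'' x
      assume "size M'' = size ?M'" "sum_mset M'' = sum_mset ?M'" "\<forall>a\<in>#M''. \<bar>a\<bar> \<le> 1"
        "size {#a \<in># M''. \<bar>a\<bar> < 1#} \<le> 1" "b < x"
      then show "poly ((pderiv ^^ k) (root_poly M'')) x > 0"
        using less.prems(2)[of M'' x] ac'(1) unfolding M by (simp add: add.assoc[symmetric])
    qed
    then show ?thesis unfolding M using higher_pderiv_spread_roots[OF ac'(1)[symmetric] ac'(2), of b k Q'] by blast
  qed
qed

subsection \<open>Derivatives of powers of \<open>x^2 - 1\<close>\<close>

text \<open>Case \<open>k = 0\<close> is the derivative of \<open>(x^2 - 1) p' = 2 N x p\<close>,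
  and each further differentiation raises \<open>k\<close> by one. \<open>E\<close> holds the
  equation as a polynomial so that it can be differentiated.\<close>

lemma legendre_power_ode:
  fixes N k :: nat and x :: real
  defines "p \<equiv> [:-1, 0, 1:] ^ N"
  shows "(x\<^sup>2 - 1) * poly ((pderiv ^^ (k + 2)) p) x
    + 2 * (real k + 1 - real N) * x * poly ((pderiv ^^ (k + 1)) p) x
    = (real k + 1) * (2 * real N - real k) * poly ((pderiv ^^ k) p) x"
proof -
  define E where "E k = [:-1, 0, 1:] * (pderiv ^^ (k + 2)) p
    + Polynomial.smult (2 * (real k + 1 - real N)) ([:0, 1:] * (pderiv ^^ (k + 1)) p)
    - Polynomial.smult ((real k + 1) * (2 * real N - real k)) ((pderiv ^^ k) p)" for k
  have "E k = 0"
  proof (induction k)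
    case 0
    have "[:-1, 0, 1:] * pderiv p = Polynomial.smult (2 * real N) ([:0, 1:] * p)"
    proof (cases N)
      case 0
      then show ?thesis unfolding p_def by simp
    next
      case (Suc m)
      show ?thesis unfolding p_def Suc pderiv_power_Suc
        by (rule poly_ext) (simp add: pderiv_pCons algebra_simps)
    qed
    from arg_cong[OF this, of pderiv]
    have "[:-1, 0, 1:] * pderiv (pderiv p) + pderiv [:-1, 0, 1:] * pderiv p
        = Polynomial.smult (2 * real N) ([:0, 1:] * pderiv p + pderiv [:0, 1:] * p)"
      by (simp only: pderiv_mult pderiv_smult)
        (simp only: mult.commute add.commute)
    from arg_cong[OF this, of "\<lambda>r. poly r x" for x]
    show ?case unfolding E_def
      by (intro poly_ext) (simp add: pderiv_pCons algebra_simps numeral_2_eq_2)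
  next
    case (Suc k)
    then have "poly (pderiv (E k)) x = 0" for x by simp
    then have "poly (E (Suc k)) x = 0" for x unfolding E_def
      by (simp add: pderiv_mult pderiv_smult pderiv_add pderiv_diff pderiv_pCons algebra_simps numeral_2_eq_2)
    then show ?case by (intro poly_ext) simp
  qed
  then have "poly (E k) x = 0" by simp
  then show ?thesis unfolding E_def by (simp add: algebra_simps power2_eq_square)
qed

text \<open>Downward induction from \<open>j = 2 N\<close>, where the derivative is a positive
  constant. At \<open>x = 1\<close> the differential equation loses its leading term and, thanks to
  \<open>N \<le> j\<close>, expresses the \<open>j\<close>-th derivative as a positive multiple of
  the next one; beyond 1 the \<open>j\<close>-th derivative increases.\<close>

lemma legendre_power_higher_pderiv_pos:
  fixes N :: nat
  assumes "N \<le> j" and "j \<le> 2 * N" and "1 \<le> x"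
  shows "poly ((pderiv ^^ j) ([:-1, 0, 1::real:] ^ N)) x > 0"
  using assms(2,1,3)
proof (induction j arbitrary: x rule: inc_induct)
  case base
  let ?p = "[:-1, 0, 1::real:] ^ N"
  have deg: "degree ?p = 2 * N" by (simp add: degree_power_eq)
  have lc: "coeff ?p (2 * N) = 1" using deg lead_coeff_power[of "[:-1, 0, 1::real:]" N] by simp
  have "degree ((pderiv ^^ (2 * N)) ?p) = 0" unfolding degree_higher_pderiv deg by simp
  then obtain c where c: "(pderiv ^^ (2 * N)) ?p = [:c:]" by (rule degree_eq_zeroE)
  have "c = coeff ((pderiv ^^ (2 * N)) ?p) 0" unfolding c by simp
  also have "\<dots> > 0" unfolding coeff_higher_pderiv using lc by (simp add: pochhammer_pos)
  finally show ?case unfolding c by simp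
next
  case (step j)
  let ?p = "[:-1, 0, 1::real:] ^ N"
  have pos: "poly ((pderiv ^^ Suc j) ?p) t > 0" if "1 \<le> t" for t using step that by simp
  have "2 * (real j + 1 - real N) * poly ((pderiv ^^ Suc j) ?p) 1
      = (real j + 1) * (2 * real N - real j) * poly ((pderiv ^^ j) ?p) 1"
    using legendre_power_ode[of 1 j N] by simp
  moreover have "2 * (real j + 1 - real N) * poly ((pderiv ^^ Suc j) ?p) 1 > 0"
    using pos[of 1] step.prems by (intro mult_pos_pos) auto
  moreover have "(real j + 1) * (2 * real N - real j) > 0" using step.hyps by (intro mult_pos_pos) auto
  ultimately have 1: "poly ((pderiv ^^ j) ?p) 1 > 0" by (metis zero_less_mult_pos)
  have "poly ((pderiv ^^ j) ?p) 1 \<le> poly ((pderiv ^^ j) ?p) x"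
  proof (rule DERIV_nonneg_imp_nondecreasing[OF step.prems(2)])
    fix t :: real assume "1 \<le> t"
    then show "\<exists>y. (poly ((pderiv ^^ j) ?p) has_real_derivative y) (at t) \<and> 0 \<le> y"
      using pos[of t] by (intro exI[of _ "poly ((pderiv ^^ Suc j) ?p) t"]) (auto intro!: poly_DERIV)
  qed
  then show ?case using 1 by simp
qed

lemma uhp_free_legendre_power: "uhp_free (map_poly of_real ([:-1, 0, 1::real:] ^ N))"
proof -
  have "poly ([:-1, 0, 1:]) z \<noteq> 0" if "Im z > 0" for z :: complex
  proof
    assume "poly ([:-1, 0, 1:]) z = 0"
    then have "(z - 1) * (z + 1) = 0" by (simp add: algebra_simps)
    then have "z = 1 \<or> z = -1" by (simp only: mult_eq_0_iff right_minus_eq add_eq_0_iff2)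
    then show False using that by auto
  qed
  then show ?thesis unfolding uhp_free_def of_real_poly_hom.hom_power by simp
qed

lemma poly_IVT_root:
  fixes p :: "real poly"
  assumes "a \<le> b" and "poly p a \<le> 0" and "0 < poly p b"
  shows "\<exists>r\<ge>a. r < b \<and> poly p r = 0"
proof -
  have "\<exists>r\<ge>a. r \<le> b \<and> poly p r = 0"
    by (rule IVT) (use assms in \<open>auto intro: poly_isCont\<close>)
  then obtain r where "a \<le> r" "r \<le> b" "poly p r = 0" by blast
  moreover have "r \<noteq> b" using calculation assms(3) by auto
  ultimately show ?thesis by force
qed

text \<open>To the right of the largest root \<open>y\<close> in \<open>[x, 1]\<close>, the function
  \<open>q^2 (1 - t^2)^\<alpha>\<close> would decrease; being zero at \<open>y\<close>, it could not
  become positive. The assumption \<open>disc\<close> makes the discriminant \<open>?D\<close>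
  positive, which fixes the sign of the derivative.\<close>

lemma legendre_power_higher_pderiv_root_bound:
  fixes N k :: nat and b :: real
  assumes N: "N \<le> k" "k < 2 * N" and b: "0 \<le> b"
    and disc: "\<And>x. b < x \<Longrightarrow> (real k + 1) * (2 * real N - real k) < x\<^sup>2 * ((real N)\<^sup>2 + real k + 1)"
    and x: "b < x"
  shows "poly ((pderiv ^^ k) ([:-1, 0, 1::real:] ^ N)) x > 0"
proof (rule ccontr)
  define q where "q j = (pderiv ^^ (k + j)) ([:-1, 0, 1::real:] ^ N)" for j
  define m where "m = k - N"
  define \<alpha> where "\<alpha> = real (Suc m)"
  have \<alpha>: "\<alpha> = real k + 1 - real N" unfolding \<alpha>_def m_def using N(1) by (simp add: of_nat_diff)
  assume "\<not> poly ((pderiv ^^ k) ([:-1, 0, 1::real:] ^ N)) x > 0"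
  then have qx: "poly (q 0) x \<le> 0" unfolding q_def by simp
  have pos1: "poly (q 0) t > 0" if "1 \<le> t" for t
    unfolding q_def using legendre_power_higher_pderiv_pos[of N k t] N that by simp
  have x1: "x < 1" using qx pos1[of x] by (meson not_le)
  let ?Z = "{t. x \<le> t \<and> t \<le> 1 \<and> poly (q 0) t = 0}"
  have nz: "q 0 \<noteq> 0" using pos1[of 1] by auto
  have fin: "finite ?Z" using poly_roots_finite[OF nz] by (rule finite_subset[rotated]) auto
  obtain r0 where "x \<le> r0" "r0 < 1" "poly (q 0) r0 = 0"
    using poly_IVT_root[of x 1 "q 0"] x1 qx pos1[of 1] by auto
  then have ne: "?Z \<noteq> {}" by (metis (mono_tags, lifting) empty_iff less_imp_le mem_Collect_eq)
  define y where "y = Max ?Z"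
  have "y \<in> ?Z" unfolding y_def using fin ne by (rule Max_in)
  then have y: "x \<le> y" "poly (q 0) y = 0" "y \<le> 1" by auto
  have y1: "y < 1" using y pos1[of 1] by (cases "y = 1") auto
  have ymax: "t \<le> y" if "t \<in> ?Z" for t unfolding y_def using fin that by (rule Max_ge)
  have qpos: "poly (q 0) t > 0" if t: "y < t" "t \<le> 1" for t
  proof (rule ccontr)
    assume "\<not> poly (q 0) t > 0"
    then obtain r where "t \<le> r" "r < 1" "poly (q 0) r = 0"
      using poly_IVT_root[of t 1 "q 0"] t pos1[of 1] by auto
    then show False using ymax[of r] y t by auto
  qed
  \<comment> \<open>Inserting the differential equation into \<open>q' ^ 2 \<ge> q * q''\<close> gives a quadratic inequality for
    \<open>q' / q\<close>; \<open>T\<close> is \<open>q\<close> times the distance of \<open>(1 - t^2) * q' / q\<close> from the vertex \<open>\<alpha> * t\<close> of the parabola.\<close>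
  define T where "T = Polynomial.smult \<alpha> ([:0, 1:] * q 0) - [:1, 0, -1:] * q 1"
  have T: "poly T t = \<alpha> * t * poly (q 0) t - (1 - t\<^sup>2) * poly (q 1) t" for t
    unfolding T_def by (simp add: algebra_simps power2_eq_square)
  have "interlaces (q 1) (q 0)"
    using interlaces_higher_pderiv[OF interlaces_pderiv_self[OF uhp_free_legendre_power[of N]], of k] nz
    unfolding q_def by (simp add: funpow_swap1)
  then have lag: "poly (q 0) t * poly (q 2) t \<le> (poly (q 1) t)\<^sup>2" for t
    using interlaces_wronskian[of "q 1" "q 0" t] unfolding q_def by (simp add: power2_eq_square numeral_2_eq_2)
  have Tnz: "poly T t \<noteq> 0" if "y < t" "t < 1" for t
  proof -
    let ?D = "\<alpha>\<^sup>2 * t\<^sup>2 - (1 - t\<^sup>2) * ((real k + 1) * (2 * real N - real k))"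
    have "?D = t\<^sup>2 * ((real N)\<^sup>2 + real k + 1) - (real k + 1) * (2 * real N - real k)"
      unfolding \<alpha> by (simp add: power2_eq_square algebra_simps)
    then have D: "?D > 0" using disc[of t] x y that by simp
    have t1: "1 - t\<^sup>2 > 0" using that x y b by (simp add: abs_square_less_1)
    have "(t\<^sup>2 - 1) * poly (q 2) t + 2 * \<alpha> * t * poly (q 1) t
        = (real k + 1) * (2 * real N - real k) * poly (q 0) t"
      using legendre_power_ode[of t k N] unfolding q_def \<alpha> by simp
    then have ode: "(1 - t\<^sup>2) * poly (q 2) t = 2 * \<alpha> * t * poly (q 1) t - (real k + 1) * (2 * real N - real k) * poly (q 0) t"
      by (simp add: algebra_simps)
    have "0 \<le> (1 - t\<^sup>2) * ((1 - t\<^sup>2) * ((poly (q 1) t)\<^sup>2 - poly (q 0) t * poly (q 2) t))"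
      using t1 lag[of t] by (intro mult_nonneg_nonneg) auto
    also have "\<dots> = (1 - t\<^sup>2) * ((1 - t\<^sup>2) * (poly (q 1) t)\<^sup>2 - poly (q 0) t * ((1 - t\<^sup>2) * poly (q 2) t))"
      by (simp add: algebra_simps)
    also have "\<dots> = (poly T t)\<^sup>2 - ?D * (poly (q 0) t)\<^sup>2"
      unfolding ode T by (simp add: algebra_simps power2_eq_square)
    finally have "?D * (poly (q 0) t)\<^sup>2 \<le> (poly T t)\<^sup>2" by simp
    moreover have "?D * (poly (q 0) t)\<^sup>2 > 0" using D qpos[of t] that by simp
    ultimately show ?thesis by auto
  qed
  \<comment> \<open>\<open>T\<close> has no zero on \<open>(y, 1)\<close> and is positive at 1,
    where only the term \<open>\<alpha> t q\<close> survives.\<close>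
  have Tpos: "poly T t > 0" if t: "y < t" "t < 1" for t
  proof (rule ccontr)
    assume "\<not> poly T t > 0"
    moreover have "poly T 1 > 0" unfolding T using pos1[of 1] by (simp add: \<alpha>_def)
    ultimately obtain r where "t \<le> r" "r < 1" "poly T r = 0"
      using poly_IVT_root[of t 1 T] t by auto
    then show False using Tnz[of r] t by simp
  qed
  define s where "s = (y + 1) / 2"
  have s: "y < s" "s < 1" unfolding s_def using y1 by auto
  have sq: "1 - t\<^sup>2 > 0" if "y \<le> t" "t < 1" for t
    using that x y b by (simp add: abs_square_less_1)
  \<comment> \<open>The exponent \<open>Suc m\<close>, which equals \<open>\<alpha>\<close>, is
    chosen so that the derivative of this weighted square is
    \<open>-2 q (1 - t^2)^m T\<close>.\<close>
  have "(poly (q 0) s)\<^sup>2 * (1 - s\<^sup>2) ^ Suc m \<le> (poly (q 0) y)\<^sup>2 * (1 - y\<^sup>2) ^ Suc m"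
  proof (rule DERIV_nonpos_imp_nonincreasing[of y s "\<lambda>t. (poly (q 0) t)\<^sup>2 * (1 - t\<^sup>2) ^ Suc m"])
    fix t assume t: "y \<le> t" "t \<le> s"
    have q1: "(poly (q 0) has_real_derivative poly (q 1) t) (at t)"
      unfolding q_def by (auto intro!: poly_DERIV)
    have "((\<lambda>t. 1 - t\<^sup>2) has_real_derivative - 2 * t) (at t)"
      by (auto intro!: derivative_eq_intros)
    note D = DERIV_mult[OF DERIV_power_Suc[OF q1, of 1] DERIV_power_Suc[OF this, of m]]
    have E: "(1 + real 1) * (poly (q 1) t * poly (q 0) t ^ 1) * (1 - t\<^sup>2) ^ Suc m
        + (1 + real m) * (- 2 * t * (1 - t\<^sup>2) ^ m) * (poly (q 0) t)\<^sup>2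
        = - 2 * poly (q 0) t * (1 - t\<^sup>2) ^ m * poly T t"
      unfolding T \<alpha>_def by (simp add: algebra_simps power2_eq_square)
    have "((\<lambda>t. (poly (q 0) t)\<^sup>2 * (1 - t\<^sup>2) ^ Suc m) has_real_derivative
        - 2 * poly (q 0) t * (1 - t\<^sup>2) ^ m * poly T t) (at t)"
      using D unfolding Suc_1 E .
    moreover have "- 2 * poly (q 0) t * (1 - t\<^sup>2) ^ m * poly T t \<le> 0"
    proof (cases "t = y")
      case False
      then have "0 \<le> 2 * poly (q 0) t * (1 - t\<^sup>2) ^ m * poly T t"
        using qpos[of t] Tpos[of t] sq[of t] t s by (intro mult_nonneg_nonneg) auto
      then show ?thesis by simp
    qed (simp add: y)
    ultimately show "\<exists>u. ((\<lambda>t. (poly (q 0) t)\<^sup>2 * (1 - t\<^sup>2) ^ Suc m) has_real_derivative u) (at t) \<and> u \<le> 0"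
      by blast
  qed (use s in simp)
  moreover have "(poly (q 0) s)\<^sup>2 * (1 - s\<^sup>2) ^ Suc m > 0"
    using qpos[of s] sq[of s] s by (intro mult_pos_pos) auto
  ultimately show False using y by simp
qed

section \<open>Extremal root configurations and the resulting bound\<close>

lemma extremal_root_multiset:
  fixes M :: "real multiset"
  assumes "\<forall>a\<in>#M. \<bar>a\<bar> \<le> 1" and "sum_mset M = 0" and "size {#a \<in># M. \<bar>a\<bar> < 1#} \<le> 1"
  shows "root_poly M = [:-1, 0, 1:] ^ (size M div 2) * [:0, 1:] ^ (size M mod 2)"
proof -
  define u where "u = count M 1"
  define v where "v = count M (-1)"
  let ?R = "{#a \<in># M. \<bar>a\<bar> < 1#}"
  have split: "M = replicate_mset u 1 + replicate_mset v (-1) + ?R"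
  proof (rule multiset_eqI)
    fix a
    have "count M a = 0" if "\<not> \<bar>a\<bar> \<le> 1" using assms(1) that by (metis not_in_iff)
    moreover have "a = 1 \<or> a = -1" if "\<not> \<bar>a\<bar> < 1" "\<bar>a\<bar> \<le> 1" using that by linarith
    ultimately show "count M a = count (replicate_mset u 1 + replicate_mset v (-1) + ?R) a"
      unfolding u_def v_def by (cases "\<bar>a\<bar> < 1"; cases "\<bar>a\<bar> \<le> 1") auto
  qed
  have sum: "real u - real v + sum_mset ?R = 0"
    using assms(2) by (subst (asm) split) simp
  have base: "root_poly (replicate_mset w 1 + replicate_mset w (-1)) = [:-1, 0, 1:] ^ w" for w
  proof -
    have "[:-1, 1:] * [:1, 1:] = [:-1, 0, 1::real:]" by simp
    then show ?thesis by (simp add: flip: power_mult_distrib)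
  qed
  show ?thesis
  proof (cases "?R = {#}")
    case True
    then have "u = v" using sum unfolding True by simp
    then have M: "M = replicate_mset u 1 + replicate_mset u (-1)" using split True by simp
    then have "size M = 2 * u" by (metis mult_2 size_replicate_mset size_union)
    then show ?thesis using base[of u] M by simp
  next
    case False
    then obtain a where R: "?R = {#a#}" using assms(3)
      by (metis One_nat_def le_Suc_eq le_zero_eq size_1_singleton_mset size_eq_0_iff_empty)
    have "a \<in># ?R" unfolding R by simp
    then have a1: "\<bar>a\<bar> < 1" by simp
    \<comment> \<open>The vanishing sum makes the interior root an integer, hence 0.\<close>
    have "of_int (int v - int u) = a" using sum R by simp
    with a1 have "\<bar>int v - int u\<bar> < 1" by linarith
    then have uv: "u = v" by simp
    then have a: "a = 0" using sum R by simp
    have M: "M = add_mset 0 (replicate_mset u 1 + replicate_mset u (-1))"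
      using split uv a R by simp
    then have "size M = Suc (2 * u)" by (metis mult_2 size_add_mset size_replicate_mset size_union)
    moreover have "root_poly M = [:0, 1:] * [:-1, 0, 1:] ^ u"
      unfolding M image_mset_add_mset prod_mset.add_mset base by simp
    ultimately show ?thesis by simp
  qed
qed

text \<open>With \<open>k = c n\<close> the condition on \<open>b\<close> reads
  \<open>4 (c - c^2) \<le> b^2\<close>. For odd size the extremal polynomial is treated as a
  multiple of a derivative of \<open>(x^2 - 1)^(N + 1)\<close>, which shifts both \<open>N\<close>
  and \<open>k\<close> by one.\<close>

lemma higher_pderiv_root_poly_pos:
  fixes M :: "real multiset" and b :: real
  assumes M: "\<forall>a\<in>#M. \<bar>a\<bar> \<le> 1" "sum_mset M = 0" and k: "size M \<le> 2 * k" "k < size M"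
    and b: "0 \<le> b" "4 * real k * (real (size M) - real k) \<le> b\<^sup>2 * (real (size M))\<^sup>2"
  shows "\<forall>x>b. poly ((pderiv ^^ k) (root_poly M)) x > 0"
proof (rule higher_pderiv_pos_reduction[OF M(1)])
  fix M' x
  assume M': "size M' = size M" "sum_mset M' = sum_mset M" "\<forall>a\<in>#M'. \<bar>a\<bar> \<le> 1"
    "size {#a \<in># M'. \<bar>a\<bar> < 1#} \<le> 1" and x: "b < x"
  define n where "n = size M"
  have nk: "n \<le> 2 * k" "k < n" using k unfolding n_def by auto
  then have kn: "real n \<le> 2 * real k" "real k < real n" by linarith+
  have disc: "4 * real k * (real n - real k) < t\<^sup>2 * (real n)\<^sup>2" if "b < t" for t
  proof -
    have "b\<^sup>2 < t\<^sup>2" using that b(1) by (simp add: power_strict_mono)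
    then have "b\<^sup>2 * (real n)\<^sup>2 < t\<^sup>2 * (real n)\<^sup>2" using kn by simp
    then show ?thesis using b(2) unfolding n_def by linarith
  qed
  have root: "root_poly M' = [:-1, 0, 1:] ^ (n div 2) * [:0, 1:] ^ (n mod 2)"
    unfolding n_def using extremal_root_multiset[OF M'(3)] M' M(2) by simp
  have n0: "real n > 0" using kn by simp
  \<comment> \<open>Here \<open>a\<close> and \<open>c\<close> are the coefficients in the
    hypothesis \<open>disc\<close> of the root bound: \<open>k + 1\<close> and
    \<open>N^2 + k + 1\<close>, or their shifted versions for odd \<open>n\<close>. It suffices that
    the squared bound \<open>a (n - k) / c\<close> is at most
    \<open>4 k (n - k) / n^2\<close>.\<close>
  have key: "a * (real n - real k) < t\<^sup>2 * c"
    if "b < t" "a * (real n)\<^sup>2 \<le> 4 * real k * c" "c > 0" for a c t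
  proof -
    have "(a * (real n)\<^sup>2) * (real n - real k) \<le> (4 * real k * c) * (real n - real k)"
      using that kn by (intro mult_right_mono) auto
    also have "\<dots> = c * (4 * real k * (real n - real k))" by simp
    also have "\<dots> < c * (t\<^sup>2 * (real n)\<^sup>2)" using that(3) disc[OF that(1)] by (rule mult_strict_left_mono[rotated])
    finally have "(a * (real n - real k)) * (real n)\<^sup>2 < (t\<^sup>2 * c) * (real n)\<^sup>2" by (simp add: algebra_simps)
    then show ?thesis using n0 by (simp add: mult_less_cancel_right)
  qed
  \<comment> \<open>Both come from \<open>n \<le> 2 k\<close>, the form that
    \<open>c \<ge> 1/2\<close> takes here.\<close>
  have sq: "(real n)\<^sup>2 \<le> 4 * (real k)\<^sup>2" "(real n)\<^sup>2 \<le> 2 * real k * real n"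
    using power_mono[of "real n" "2 * real k" 2] mult_right_mono[of "real n" "2 * real k" "real n"] kn
    by (auto simp: power2_eq_square)
  show "poly ((pderiv ^^ k) (root_poly M')) x > 0"
  proof (cases "even n")
    case True
    then obtain N where N: "n = 2 * N" by blast
    have "poly ((pderiv ^^ k) ([:-1, 0, 1::real:] ^ N)) x > 0"
    proof (rule legendre_power_higher_pderiv_root_bound[OF _ _ b(1) _ x])
      fix t assume t: "b < t"
      have "(real k + 1) * (real n)\<^sup>2 \<le> 4 * real k * ((real N)\<^sup>2 + real k + 1)"
        using sq unfolding N by (simp add: power2_eq_square algebra_simps)
      from key[OF t this] show "(real k + 1) * (2 * real N - real k) < t\<^sup>2 * ((real N)\<^sup>2 + real k + 1)"
        unfolding N by (simp add: add_nonneg_pos)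
    qed (use nk N in auto)
    then show ?thesis using root N by simp
  next
    case False
    then obtain N where N: "n = 2 * N + 1" by (metis oddE)
    have "poly ((pderiv ^^ Suc k) ([:-1, 0, 1::real:] ^ Suc N)) x > 0"
    proof (rule legendre_power_higher_pderiv_root_bound[OF _ _ b(1) _ x])
      fix t assume t: "b < t"
      have "(real (Suc k) + 1) * (real n)\<^sup>2 \<le> 4 * real k * ((real (Suc N))\<^sup>2 + real (Suc k) + 1)"
      proof -
        have "4 * real k * ((real (Suc N))\<^sup>2 + real (Suc k) + 1) = real k * (real n + 1)\<^sup>2 + 4 * real k * (real k + 2)"
          unfolding N by (simp add: power2_eq_square algebra_simps)
        also have "\<dots> = real k * (real n)\<^sup>2 + 2 * real k * real n + 4 * (real k)\<^sup>2 + 9 * real k"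
          by (simp add: power2_eq_square algebra_simps)
        finally have rhs: "4 * real k * ((real (Suc N))\<^sup>2 + real (Suc k) + 1) = \<dots>" .
        have "(real (Suc k) + 1) * (real n)\<^sup>2 = real k * (real n)\<^sup>2 + (real n)\<^sup>2 + (real n)\<^sup>2"
          by (simp add: algebra_simps)
        also have "\<dots> \<le> real k * (real n)\<^sup>2 + 2 * real k * real n + 4 * (real k)\<^sup>2 + 9 * real k"
          using sq by linarith
        finally show ?thesis unfolding rhs .
      qed
      moreover have "(real (Suc N))\<^sup>2 + real (Suc k) + 1 > 0"
        using zero_le_power2[of "real (Suc N)"] by linarith
      ultimately have "(real (Suc k) + 1) * (real n - real k) < t\<^sup>2 * ((real (Suc N))\<^sup>2 + real (Suc k) + 1)"
        by (rule key[OF t])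
      moreover have "real n - real k = 2 * real (Suc N) - real (Suc k)" unfolding N by simp
      ultimately show "(real (Suc k) + 1) * (2 * real (Suc N) - real (Suc k)) < t\<^sup>2 * ((real (Suc N))\<^sup>2 + real (Suc k) + 1)"
        by simp
    qed (use nk N in auto)
    moreover have "pderiv ([:-1, 0, 1::real:] ^ Suc N)
        = Polynomial.smult (2 * real (Suc N)) ([:-1, 0, 1:] ^ N * [:0, 1:])"
      unfolding pderiv_power_Suc by (rule poly_ext) (simp add: pderiv_pCons algebra_simps)
    ultimately have "2 * real (Suc N) * poly ((pderiv ^^ k) ([:-1, 0, 1:] ^ N * [:0, 1:])) x > 0"
      by (metis comp_apply funpow_Suc_right higher_pderiv_smult poly_smult)
    then have "poly ((pderiv ^^ k) ([:-1, 0, 1:] ^ N * [:0, 1:])) x > 0"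
      by (rule zero_less_mult_pos) simp
    then show ?thesis using root N by simp
  qed
qed

subsection \<open>Characteristic polynomials of principal submatrices\<close>

interpretation cnj_hom: inj_idom_hom cnj by unfold_locales auto
interpretation cnj_poly_hom: map_poly_inj_idom_hom cnj ..

text \<open>The block \<open>x - A\<close> on \<open>S\<close> is completed by the identity, so that its determinant is the
  characteristic polynomial of the principal submatrix on \<open>S\<close> without any reindexing.\<close>

definition principal_char_mat :: "complex mat \<Rightarrow> nat set \<Rightarrow> complex poly mat" where
  "principal_char_mat A S = mat (dim_row A) (dim_row A) (\<lambda>(i, j).
     if i \<in> S \<and> j \<in> S then (if i = j then [:- A $$ (i, j), 1:] else [:- A $$ (i, j):])
     else if i = j then 1 else 0)"

definition principal_char_poly :: "complex mat \<Rightarrow> nat set \<Rightarrow> complex poly" where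
  "principal_char_poly A S = det (principal_char_mat A S)"

lemma principal_char_mat_carrier [simp]:
  "A \<in> carrier_mat n n \<Longrightarrow> principal_char_mat A S \<in> carrier_mat n n"
  by (simp add: principal_char_mat_def)

lemma principal_char_poly_Leibniz:
  assumes "A \<in> carrier_mat n n"
  shows "principal_char_poly A S = (\<Sum>p | p permutes {0..<n}. signof p *
    (\<Prod>i = 0..<n. principal_char_mat A S $$ (i, p i)))"
  unfolding principal_char_poly_def by (rule det_def') (use assms in simp)

lemma principal_char_poly_full:
  assumes "A \<in> carrier_mat n n"
  shows "principal_char_poly A {0..<n} = char_poly A"
proof -
  have "principal_char_mat A {0..<n} = char_poly_matrix A"
    using assms by (intro eq_matI) (auto simp: principal_char_mat_def char_poly_matrix_def)
  then show ?thesis by (simp add: principal_char_poly_def char_poly_def)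
qed

lemma principal_char_poly_empty: "principal_char_poly A {} = 1"
proof -
  have "principal_char_mat A {} = 1\<^sub>m (dim_row A)"
    by (intro eq_matI) (auto simp: principal_char_mat_def)
  then show ?thesis by (simp add: principal_char_poly_def)
qed

text \<open>Row \<open>i\<close> of the matrix for \<open>S - {i}\<close> is a unit row, so in the
  Leibniz expansion only permutations fixing \<open>i\<close> survive; along these the remaining
  entries agree with those for \<open>S\<close>.\<close>

lemma prod_principal_char_mat_remove:
  assumes A: "A \<in> carrier_mat n n" and p: "p permutes {0..<n}" and i: "i \<in> S" "i < n"
  shows "(\<Prod>j = 0..<n. principal_char_mat A (S - {i}) $$ (j, p j))
    = (if p i = i then \<Prod>j\<in>{0..<n} - {i}. principal_char_mat A S $$ (j, p j) else 0)"
proof -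
  have pn: "p j < n" if "j < n" for j using p that by (metis atLeastLessThan_iff permutes_in_image zero_le)
  have dim: "dim_row A = n" using A by simp
  have "(\<Prod>j = 0..<n. principal_char_mat A (S - {i}) $$ (j, p j))
     = principal_char_mat A (S - {i}) $$ (i, p i) *
       (\<Prod>j\<in>{0..<n} - {i}. principal_char_mat A (S - {i}) $$ (j, p j))"
    using i by (intro prod.remove) auto
  also have "principal_char_mat A (S - {i}) $$ (i, p i) = (if p i = i then 1 else 0)"
    using i pn[of i] by (auto simp: principal_char_mat_def dim)
  also have "(if p i = i then 1 else 0) * (\<Prod>j\<in>{0..<n} - {i}. principal_char_mat A (S - {i}) $$ (j, p j))
    = (if p i = i then \<Prod>j\<in>{0..<n} - {i}. principal_char_mat A S $$ (j, p j) else 0)"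
  proof (cases "p i = i")
    case True
    have "principal_char_mat A (S - {i}) $$ (j, p j) = principal_char_mat A S $$ (j, p j)"
      if "j \<in> {0..<n} - {i}" for j
    proof -
      have "p j \<noteq> i" using True p that by (metis DiffE permutes_inj injD singletonI)
      then show ?thesis using that pn[of j] by (auto simp: principal_char_mat_def dim)
    qed
    then show ?thesis using True by simp
  qed simp
  finally show ?thesis .
qed

lemma pderiv_signof_mult: "pderiv (signof p * (X :: complex poly)) = signof p * pderiv X"
  by (simp add: sign_def pderiv_minus)

text \<open>In each Leibniz product only diagonal entries on \<open>S\<close> depend on the
  variable, with derivative 1; differentiating such a factor leaves the product for
  \<open>S - {i}\<close>.\<close>

lemma pderiv_principal_char_poly:
  assumes A: "A \<in> carrier_mat n n" and S: "S \<subseteq> {0..<n}"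
  shows "pderiv (principal_char_poly A S) = (\<Sum>i\<in>S. principal_char_poly A (S - {i}))"
proof -
  let ?M = "principal_char_mat A S"
  have dim: "dim_row A = n" using A by simp
  have "pderiv (\<Prod>i = 0..<n. ?M $$ (i, p i)) = (\<Sum>i\<in>S. \<Prod>j = 0..<n. principal_char_mat A (S - {i}) $$ (j, p j))"
    if p: "p permutes {0..<n}" for p
  proof -
    have pn: "p j < n" if "j < n" for j using p that by (metis atLeastLessThan_iff permutes_in_image zero_le)
    have "pderiv (\<Prod>i = 0..<n. ?M $$ (i, p i))
        = (\<Sum>i = 0..<n. (\<Prod>j\<in>{0..<n} - {i}. ?M $$ (j, p j)) * pderiv (?M $$ (i, p i)))"
      by (rule pderiv_prod)
    also have "\<dots> = (\<Sum>i = 0..<n. if i \<in> S then (\<Prod>j = 0..<n. principal_char_mat A (S - {i}) $$ (j, p j)) else 0)"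
    proof (rule sum.cong[OF refl])
      fix i assume "i \<in> {0..<n}"
      then have i: "i < n" by simp
      have "pderiv (?M $$ (i, p i)) = (if i \<in> S \<and> p i = i then 1 else 0)"
        using i pn[OF i] by (auto simp: principal_char_mat_def dim pderiv_pCons)
      then show "(\<Prod>j\<in>{0..<n} - {i}. ?M $$ (j, p j)) * pderiv (?M $$ (i, p i))
          = (if i \<in> S then (\<Prod>j = 0..<n. principal_char_mat A (S - {i}) $$ (j, p j)) else 0)"
        using prod_principal_char_mat_remove[OF A p _ i, of S] by auto
    qed
    also have "\<dots> = (\<Sum>i\<in>S. \<Prod>j = 0..<n. principal_char_mat A (S - {i}) $$ (j, p j))"
      using S by (simp add: sum.If_cases Int_absorb1)
    finally show ?thesis .
  qed
  then have "pderiv (principal_char_poly A S) = (\<Sum>p | p permutes {0..<n}. signof p *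
      (\<Sum>i\<in>S. \<Prod>j = 0..<n. principal_char_mat A (S - {i}) $$ (j, p j)))"
    unfolding principal_char_poly_Leibniz[OF A] pderiv_sum by (intro sum.cong) (auto simp: pderiv_signof_mult)
  also have "\<dots> = (\<Sum>i\<in>S. principal_char_poly A (S - {i}))"
    unfolding principal_char_poly_Leibniz[OF A] sum_distrib_left by (rule sum.swap)
  finally show ?thesis .
qed

text \<open>The determinant is affine in the diagonal entry at \<open>i\<close>, with the
  complementary minor as slope. Taking \<open>c\<close> to be the imaginary unit turns the
  interlacing combination into one determinant.\<close>

lemma principal_char_poly_perturb:
  assumes A: "A \<in> carrier_mat n n" and i: "i \<in> S" "i < n"
  shows "principal_char_poly A S + Polynomial.smult c (principal_char_poly A (S - {i}))
    = det (mat n n (\<lambda>(a, d). principal_char_mat A S $$ (a, d) + (if a = i \<and> d = i then [:c:] else 0)))"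
    (is "_ = det ?K")
proof -
  let ?M = "principal_char_mat A S"
  have "(\<Prod>j = 0..<n. ?K $$ (j, p j)) = (\<Prod>j = 0..<n. ?M $$ (j, p j))
      + [:c:] * (\<Prod>j = 0..<n. principal_char_mat A (S - {i}) $$ (j, p j))"
    if p: "p permutes {0..<n}" for p
  proof -
    have pn: "p j < n" if "j < n" for j using p that by (metis atLeastLessThan_iff permutes_in_image zero_le)
    have "(\<Prod>j = 0..<n. ?K $$ (j, p j)) = ?K $$ (i, p i) * (\<Prod>j\<in>{0..<n} - {i}. ?K $$ (j, p j))"
      using i by (intro prod.remove) auto
    also have "(\<Prod>j\<in>{0..<n} - {i}. ?K $$ (j, p j)) = (\<Prod>j\<in>{0..<n} - {i}. ?M $$ (j, p j))"
      using pn by (intro prod.cong) auto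
    also have "?K $$ (i, p i) = ?M $$ (i, p i) + (if p i = i then [:c:] else 0)"
      using i pn[OF i(2)] by simp
    also have "(?M $$ (i, p i) + (if p i = i then [:c:] else 0)) * (\<Prod>j\<in>{0..<n} - {i}. ?M $$ (j, p j))
       = ?M $$ (i, p i) * (\<Prod>j\<in>{0..<n} - {i}. ?M $$ (j, p j))
       + [:c:] * (if p i = i then (\<Prod>j\<in>{0..<n} - {i}. ?M $$ (j, p j)) else 0)"
      by (simp add: distrib_right)
    also have "?M $$ (i, p i) * (\<Prod>j\<in>{0..<n} - {i}. ?M $$ (j, p j)) = (\<Prod>j = 0..<n. ?M $$ (j, p j))"
      using i by (intro prod.remove[symmetric]) auto
    finally show ?thesis unfolding prod_principal_char_mat_remove[OF A p i] .
  qed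
  moreover have "det ?K = (\<Sum>p | p permutes {0..<n}. signof p * (\<Prod>j = 0..<n. ?K $$ (j, p j)))"
    by (rule det_def') simp
  ultimately have "det ?K = (\<Sum>p | p permutes {0..<n}. signof p * (\<Prod>j = 0..<n. ?M $$ (j, p j))
      + [:c:] * (signof p * (\<Prod>j = 0..<n. principal_char_mat A (S - {i}) $$ (j, p j))))"
    by (simp only:) (intro sum.cong refl, simp add: distrib_left)
  also have "\<dots> = principal_char_poly A S + [:c:] * principal_char_poly A (S - {i})"
    unfolding principal_char_poly_Leibniz[OF A] sum.distrib sum_distrib_left ..
  finally show ?thesis by simp
qed

lemma hermitian_form_real:
  assumes A: "A \<in> carrier_mat n n" and h: "hermitian_mat A" and S: "S \<subseteq> {0..<n}"
  shows "Im (\<Sum>a\<in>S. \<Sum>d\<in>S. cnj (v a) * A $$ (a, d) * v d) = 0" (is "Im ?X = 0")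
proof -
  have e: "cnj (A $$ (a, d)) = A $$ (d, a)" if "a \<in> S" "d \<in> S" for a d
  proof -
    have "a < n" "d < n" using that S by auto
    then have "A $$ (d, a) = cnj (A $$ (a, d))"
      using h unfolding hermitian_mat_iff[OF A] by blast
    then show ?thesis by (rule sym)
  qed
  have "cnj ?X = (\<Sum>a\<in>S. \<Sum>d\<in>S. cnj (v d) * A $$ (d, a) * v a)"
    unfolding cnj_sum complex_cnj_mult complex_cnj_cnj
    by (intro sum.cong refl) (simp add: e mult_ac)
  also have "\<dots> = ?X" by (rule sum.swap)
  finally have "?X \<in> \<real>" by (simp only: Reals_cnj_iff)
  then show ?thesis by (simp only: complex_is_Real_iff)
qed

text \<open>Serves twice: with \<open>w\<close> the imaginary unit at \<open>i\<close>, to exclude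
  zeros in the upper half-plane, and with \<open>w = 0\<close>, to recognise eigenvalues.\<close>

lemma principal_kernel_vec:
  assumes A: "A \<in> carrier_mat n n" and S: "S \<subseteq> {0..<n}" and v: "v \<in> carrier_vec n"
    and K: "K \<in> carrier_mat n n" "\<And>a d. a < n \<Longrightarrow> d < n \<Longrightarrow>
      K $$ (a, d) = poly (principal_char_mat A S $$ (a, d)) z + (if a = d \<and> a \<in> S then w a else 0)"
    and v0: "\<And>a. a < n \<Longrightarrow> a \<notin> S \<Longrightarrow> v $ a = 0" and a: "a < n"
  shows "(K *\<^sub>v v) $ a = (if a \<in> S then (z + w a) * v $ a - (\<Sum>d\<in>S. A $$ (a, d) * v $ d) else 0)"
proof -
  have dim: "dim_row A = n" using A by simp
  have fin: "finite S" using S finite_subset by blast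
  have "(K *\<^sub>v v) $ a = (\<Sum>d\<in>{0..<n}. K $$ (a, d) * v $ d)"
    using K(1) v a by (auto simp: scalar_prod_def intro!: sum.cong)
  also have "\<dots> = (\<Sum>d\<in>S. K $$ (a, d) * v $ d)"
    using S v0 by (intro sum.mono_neutral_right) auto
  also have "\<dots> = (\<Sum>d\<in>S. if a \<in> S then (if d = a then (z + w a) * v $ a else 0) - A $$ (a, d) * v $ d else 0)"
    using S a by (intro sum.cong refl) (auto simp: K(2) principal_char_mat_def dim algebra_simps subset_iff)
  also have "\<dots> = (if a \<in> S then (z + w a) * v $ a - (\<Sum>d\<in>S. A $$ (a, d) * v $ d) else 0)"
    using fin by (simp add: sum_subtractf)
  finally show ?thesis .
qed

text \<open>The sum is the determinant of \<open>z - A + \<i> e\<^sub>i e\<^sub>i\<^sup>*\<close> on \<open>S\<close>, whose quadratic form has positive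
  imaginary part.\<close>

lemma uhp_free_principal_char_poly:
  assumes A: "A \<in> carrier_mat n n" and h: "hermitian_mat A" and S: "S \<subseteq> {0..<n}" and i: "i \<in> S"
  shows "uhp_free (principal_char_poly A S + Polynomial.smult \<i> (principal_char_poly A (S - {i})))"
  unfolding uhp_free_def
proof (intro allI impI notI)
  fix z assume z: "Im z > 0"
    "poly (principal_char_poly A S + Polynomial.smult \<i> (principal_char_poly A (S - {i}))) z = 0"
  have fin: "finite S" using S finite_subset by blast
  have dim: "dim_row A = n" using A by simp
  have i_n: "i < n" using i S by auto
  define w where "w a = (if a = i then \<i> else 0)" for a
  define K where "K = mat n n (\<lambda>(a, d). poly (principal_char_mat A S $$ (a, d)) z + (if a = d \<and> a \<in> S then w a else 0))"
  have K: "K \<in> carrier_mat n n" unfolding K_def by simp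
  have Kentry: "K $$ (a, d) = poly (principal_char_mat A S $$ (a, d)) z + (if a = d \<and> a \<in> S then w a else 0)"
    if "a < n" "d < n" for a d using that unfolding K_def by simp
  have "poly (principal_char_poly A S + Polynomial.smult \<i> (principal_char_poly A (S - {i}))) z = det K"
    unfolding principal_char_poly_perturb[OF A i i_n]
    by (rule poly_det_cong[of _ n]) (use i in \<open>auto simp: K_def w_def\<close>)
  then have "det K = 0" using z(2) by simp
  then obtain v where v: "v \<in> carrier_vec n" "v \<noteq> 0\<^sub>v n" "K *\<^sub>v v = 0\<^sub>v n"
    using det_0_iff_vec_prod_zero[OF K] by auto
  \<comment> \<open>Outside \<open>S\<close> the matrix \<open>K\<close> is the identity, so a
    kernel vector vanishes there.\<close>
  have v0: "v $ a = 0" if "a < n" "a \<notin> S" for a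
  proof -
    have "(K *\<^sub>v v) $ a = (\<Sum>d\<in>{0..<n}. K $$ (a, d) * v $ d)"
      using K v(1) that by (auto simp: scalar_prod_def intro!: sum.cong)
    also have "\<dots> = (\<Sum>d\<in>{0..<n}. if d = a then v $ d else 0)"
      using that by (intro sum.cong refl) (auto simp: Kentry principal_char_mat_def dim)
    also have "\<dots> = v $ a" using that by simp
    finally show ?thesis unfolding v(3) using that by simp
  qed
  have row: "(z + w a) * v $ a = (\<Sum>d\<in>S. A $$ (a, d) * v $ d)" if "a \<in> S" for a
  proof -
    have "a < n" using that S by auto
    from principal_kernel_vec[OF A S v(1) K Kentry v0 this] show ?thesis
      unfolding v(3) using that \<open>a < n\<close> by simp
  qed
  \<comment> \<open>Pairing \<open>K v = 0\<close> with \<open>v\<close> equates a real hermitian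
    form with the sum of \<open>z + w a\<close> weighted by \<open>|v a|^2\<close>; imaginary parts
    then force \<open>v = 0\<close>.\<close>
  have "(\<Sum>a\<in>S. \<Sum>d\<in>S. cnj (v $ a) * A $$ (a, d) * v $ d) = (\<Sum>a\<in>S. cnj (v $ a) * ((z + w a) * v $ a))"
    by (intro sum.cong refl) (simp add: row sum_distrib_left mult.assoc)
  also have "\<dots> = (\<Sum>a\<in>S. (z + w a) * of_real ((cmod (v $ a))\<^sup>2))"
    unfolding complex_norm_square by (simp only: mult_ac)
  finally have "Im (\<Sum>a\<in>S. (z + w a) * of_real ((cmod (v $ a))\<^sup>2)) = 0"
    using hermitian_form_real[OF A h S, of "\<lambda>a. v $ a"] by simp
  then have 0: "(\<Sum>a\<in>S. Im (z + w a) * (cmod (v $ a))\<^sup>2) = 0" by (simp add: Im_sum)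
  have pos: "Im (z + w a) > 0" for a using z(1) unfolding w_def by simp
  have "v $ a = 0" if "a \<in> S" for a
  proof -
    have "Im (z + w a) * (cmod (v $ a))\<^sup>2 = 0"
      using sum_nonneg_0[OF fin _ 0 that] pos by (simp add: less_imp_le del: plus_complex.sel)
    then show ?thesis using pos[of a] by simp
  qed
  then have "v = 0\<^sub>v n" using v(1) v0 by (intro eq_vecI) auto
  then show False using v(2) by contradiction
qed

section \<open>Real characteristic polynomials and successive deletion of indices\<close>

definition real_principal_char_poly :: "complex mat \<Rightarrow> nat set \<Rightarrow> real poly" where
  "real_principal_char_poly A S = map_poly Re (principal_char_poly A S)"

text \<open>Conjugating the coefficients transposes the matrix and leaves the determinant unchanged,
  so taking real parts loses nothing.\<close>

lemma map_poly_real_principal_char_poly: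
  assumes A: "A \<in> carrier_mat n n" and h: "hermitian_mat A" and S: "S \<subseteq> {0..<n}"
  shows "map_poly of_real (real_principal_char_poly A S) = principal_char_poly A S"
proof -
  let ?M = "principal_char_mat A S"
  have dim: "dim_row A = n" using A by simp
  have "map_mat (map_poly cnj) ?M = transpose_mat ?M"
  proof (rule eq_matI)
    fix a d assume "a < dim_row (transpose_mat ?M)" "d < dim_col (transpose_mat ?M)"
    then have ad: "a < n" "d < n" by (auto simp: principal_char_mat_def dim)
    have "cnj (A $$ (a, d)) = A $$ (d, a)"
      using h ad unfolding hermitian_mat_iff[OF A] by (metis complex_cnj_cnj)
    then show "map_mat (map_poly cnj) ?M $$ (a, d) = transpose_mat ?M $$ (a, d)"
      using ad by (auto simp: principal_char_mat_def dim)
  qed (auto simp: principal_char_mat_def)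
  then have "map_poly cnj (principal_char_poly A S) = principal_char_poly A S"
    unfolding principal_char_poly_def cnj_poly_hom.hom_det[symmetric]
    using det_transpose[OF principal_char_mat_carrier[OF A]] by simp
  then have "cnj (coeff (principal_char_poly A S) m) = coeff (principal_char_poly A S) m" for m
    by (metis coeff_map_poly complex_cnj_zero)
  then show ?thesis
    unfolding real_principal_char_poly_def
    by (intro poly_eqI) (simp add: coeff_map_poly complex_eq_iff)
qed

lemma pderiv_real_principal_char_poly:
  assumes A: "A \<in> carrier_mat n n" and h: "hermitian_mat A" and S: "S \<subseteq> {0..<n}"
  shows "pderiv (real_principal_char_poly A S) = (\<Sum>i\<in>S. real_principal_char_poly A (S - {i}))"
proof -
  have "S - {i} \<subseteq> {0..<n}" for i using S by auto
  note * = map_poly_real_principal_char_poly[OF A h this] map_poly_real_principal_char_poly[OF A h S]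
  have "map_poly complex_of_real (pderiv (real_principal_char_poly A S))
      = map_poly of_real (\<Sum>i\<in>S. real_principal_char_poly A (S - {i}))"
    unfolding of_real_hom.map_poly_pderiv of_real_poly_hom.hom_sum *
    by (rule pderiv_principal_char_poly[OF A S])
  then show ?thesis by (rule of_real_poly_hom.injectivity)
qed

text \<open>Induction through the derivative: it is a sum of \<open>card S\<close> monic polynomials
  of degree \<open>card S - 1\<close>, and comparing coefficients gives leading coefficient
  1.\<close>

lemma degree_real_principal_char_poly:
  assumes A: "A \<in> carrier_mat n n" and h: "hermitian_mat A" and S: "S \<subseteq> {0..<n}"
  shows "degree (real_principal_char_poly A S) = card S"
proof -
  have "degree (real_principal_char_poly A S) \<le> card S \<and> coeff (real_principal_char_poly A S) (card S) = 1"
    using S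
  proof (induction "card S" arbitrary: S)
    case 0
    then have "S = {}" by (metis card_0_eq finite_subset finite_atLeastLessThan)
    then show ?case by (simp add: real_principal_char_poly_def principal_char_poly_empty)
  next
    case (Suc s)
    let ?R = "real_principal_char_poly A S"
    have fin: "finite S" using Suc.prems finite_subset by blast
    have IH: "degree (real_principal_char_poly A (S - {i})) \<le> s"
        "coeff (real_principal_char_poly A (S - {i})) s = 1" if "i \<in> S" for i
    proof -
      have "s = card (S - {i})" using Suc.hyps(2) that fin by simp
      moreover have "S - {i} \<subseteq> {0..<n}" using Suc.prems by auto
      ultimately show "degree (real_principal_char_poly A (S - {i})) \<le> s"
        "coeff (real_principal_char_poly A (S - {i})) s = 1" using Suc.hyps(1) by metis+
    qed
    note D = pderiv_real_principal_char_poly[OF A h Suc.prems]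
    have "degree (pderiv ?R) \<le> s" unfolding D using IH(1) fin by (intro degree_sum_le) auto
    then have "degree ?R \<le> card S" unfolding degree_pderiv Suc.hyps(2)[symmetric] by simp
    moreover have "coeff (pderiv ?R) s = real (Suc s)"
      unfolding D coeff_sum using IH(2) Suc.hyps(2) by simp
    then have "coeff ?R (card S) = 1"
      unfolding coeff_pderiv Suc.hyps(2)[symmetric] by (simp del: of_nat_Suc)
    ultimately show ?case by simp
  qed
  then show ?thesis by (metis le_antisym le_degree one_neq_zero)
qed

text \<open>Each deletion costs one derivative: the \<open>(j + 1)\<close>-st derivative for
  \<open>S\<close> is the sum of the \<open>j\<close>-th derivatives for the sets
  \<open>S - {i}\<close>, so \<open>exists_interlaces_pos\<close> picks an index whose summand is
  still positive beyond \<open>b\<close>.\<close>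

lemma exists_principal_char_poly_pos:
  assumes A: "A \<in> carrier_mat n n" and h: "hermitian_mat A"
    and S: "S \<subseteq> {0..<n}" "j < card S"
    and pos: "\<forall>x>b. poly ((pderiv ^^ j) (real_principal_char_poly A S)) x > 0"
  shows "\<exists>T\<subseteq>S. card T = card S - j \<and> (\<forall>x>b. poly (real_principal_char_poly A T) x > 0)"
  using S pos
proof (induction j arbitrary: S)
  case 0
  then show ?case by auto
next
  case (Suc j)
  let ?R = "real_principal_char_poly A"
  let ?F = "(pderiv ^^ j) (?R S)" and ?G = "\<lambda>i. (pderiv ^^ j) (?R (S - {i}))"
  have fin: "finite S" using Suc.prems(1) finite_subset by blast
  have sub: "S - {i} \<subseteq> {0..<n}" for i using Suc.prems(1) by auto
  have degF: "degree ?F = card S - j"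
    unfolding degree_higher_pderiv degree_real_principal_char_poly[OF A h Suc.prems(1)] ..
  have degG: "degree (?G i) = card S - 1 - j" if "i \<in> S" for i
    unfolding degree_higher_pderiv degree_real_principal_char_poly[OF A h sub] using that fin by simp
  have "\<exists>i\<in>S. \<forall>t>b. poly (?G i) t > 0"
  proof (rule exists_interlaces_pos[OF fin])
    fix i assume i: "i \<in> S"
    have "interlaces (?R (S - {i})) (?R S)"
      unfolding interlaces_def map_poly_real_principal_char_poly[OF A h Suc.prems(1)]
        map_poly_real_principal_char_poly[OF A h sub]
      by (rule uhp_free_principal_char_poly[OF A h Suc.prems(1) i])
    moreover have "?F \<noteq> 0" using degF Suc.prems(2) by (metis Suc_lessD degree_0 less_irrefl zero_less_diff)
    ultimately show "interlaces (?G i) ?F" by (rule interlaces_higher_pderiv)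
    show "degree (?G i) < degree ?F" unfolding degF degG[OF i] using Suc.prems(2) by simp
    have "degree (?G i) > 0" unfolding degG[OF i] using Suc.prems(2) by simp
    then show "?G i \<noteq> 0" by auto
  next
    have "pderiv ?F = (pderiv ^^ j) (pderiv (?R S))" by (simp add: funpow_swap1)
    then show "pderiv ?F = (\<Sum>i\<in>S. ?G i)"
      unfolding pderiv_real_principal_char_poly[OF A h Suc.prems(1)] higher_pderiv_sum .
  next
    fix t assume "b < t"
    then show "poly (pderiv ?F) t > 0" using Suc.prems(3) by simp
  qed
  then obtain i where i: "i \<in> S" "\<forall>t>b. poly (?G i) t > 0" by blast
  have card: "card (S - {i}) = card S - 1" using i fin by simp
  have "j < card (S - {i})" using card Suc.prems(2) by simp
  from Suc.IH[OF sub this i(2)] obtain T where T: "T \<subseteq> S - {i}" "card T = card (S - {i}) - j"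
    "\<forall>x>b. poly (?R T) x > 0" by blast
  have "T \<subseteq> S" using T(1) by blast
  moreover have "card T = card S - Suc j" using T(2) card by simp
  ultimately show ?case using T(3) by blast
qed

subsection \<open>Eigenvalues\<close>

lemma mat_trace_mult_comm:
  assumes "X \<in> carrier_mat n n" and "Y \<in> carrier_mat n n"
  shows "mat_trace (X * Y) = mat_trace (Y * X)"
proof -
  have tr: "mat_trace (P * Q) = (\<Sum>i = 0..<n. \<Sum>j = 0..<n. P $$ (i, j) * Q $$ (j, i))"
    if "P \<in> carrier_mat n n" "Q \<in> carrier_mat n n" for P Q :: "complex mat"
    using that unfolding mat_trace_def by (auto simp: scalar_prod_def lessThan_atLeast0 intro!: sum.cong)
  show ?thesis unfolding tr[OF assms] tr[OF assms(2,1)]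
    by (subst sum.swap) (simp only: mult.commute)
qed

lemma mat_trace_eq_sum_roots:
  assumes A: "A \<in> carrier_mat n n" and c: "char_poly A = (\<Prod>a\<leftarrow>as. [:- a, 1:])"
  shows "mat_trace A = sum_list as"
proof -
  obtain B P Q where "schur_decomposition A as = (B, P, Q)" by (cases "schur_decomposition A as")
  from schur_decomposition[OF A c this]
  have sim: "similar_mat_wit A B P Q" and diag: "diag_mat B = as" by auto
  note s = similar_mat_witD2[OF A sim]
  have "mat_trace A = mat_trace (Q * (P * B))"
    unfolding s(3) using s by (intro mat_trace_mult_comm[of _ n]) auto
  also have "Q * (P * B) = B"
    using s assoc_mult_mat[OF s(7) s(6) s(5)] by simp
  also have "mat_trace B = sum_list (diag_mat B)"
    unfolding mat_trace_def diag_mat_def by (simp add: sum_list_sum_nth lessThan_atLeast0)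
  finally show ?thesis unfolding diag .
qed

lemma vec_l2_norm_smult: "vec_l2_norm (k \<cdot>\<^sub>v v) = cmod k * vec_l2_norm v"
proof -
  have "vec_l2_norm (k \<cdot>\<^sub>v v) = L2_set (\<lambda>i. cmod k * cmod (v $ i)) {..<dim_vec v}"
    unfolding vec_l2_norm_def index_smult_vec by (rule L2_set_cong) (auto simp: norm_mult)
  then show ?thesis unfolding vec_l2_norm_def by (simp add: L2_set_right_distrib)
qed

lemma eigenvalue_le_op_norm:
  assumes A: "A \<in> carrier_mat n n" and e: "eigenvalue A k"
  shows "cmod k \<le> mat_op_norm A"
proof -
  obtain v where v: "v \<in> carrier_vec n" "v \<noteq> 0\<^sub>v n" "A *\<^sub>v v = k \<cdot>\<^sub>v v"
    using e A unfolding eigenvalue_def eigenvector_def by auto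
  have "vec_l2_norm v \<noteq> 0"
  proof
    assume "vec_l2_norm v = 0"
    then have "\<forall>i\<in>{..<dim_vec v}. cmod (v $ i) = 0"
      unfolding vec_l2_norm_def by (subst (asm) L2_set_eq_0_iff) auto
    then have "v = 0\<^sub>v n" using v(1) by (intro eq_vecI) auto
    then show False using v(2) by contradiction
  qed
  then have pos: "vec_l2_norm v > 0" unfolding vec_l2_norm_def by (simp add: less_le)
  define u where "u = complex_of_real (1 / vec_l2_norm v) \<cdot>\<^sub>v v"
  have u: "u \<in> carrier_vec n" unfolding u_def using v(1) by simp
  have norm_u: "vec_l2_norm u = 1"
    unfolding u_def vec_l2_norm_smult norm_of_real using pos by simp
  have "A *\<^sub>v u = k \<cdot>\<^sub>v u"
    unfolding u_def using A v by (simp add: mult_mat_vec smult_smult_assoc mult.commute)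
  then have "cmod k = vec_l2_norm (A *\<^sub>v u)" by (simp add: vec_l2_norm_smult norm_u)
  also have "\<dots> \<le> mat_op_norm A"
    unfolding mat_op_norm_def
    by (rule cSUP_upper[OF _ mat_op_norm_bdd_above]) (use u norm_u A in auto)
  finally show ?thesis .
qed

text \<open>The hypotheses on \<open>A\<close> become conditions on roots: hermitian symmetry makes
  them real, the norm bound puts them in \<open>[-1, 1]\<close>, and the trace makes their sum
  0.\<close>

lemma real_char_poly_eq_root_poly:
  assumes A: "A \<in> carrier_mat n n" and h: "hermitian_mat A"
    and op: "mat_op_norm A \<le> 1" and tr: "mat_trace A = 0"
  obtains M where "real_principal_char_poly A {0..<n} = root_poly M" and "size M = n"
    and "\<forall>a\<in>#M. \<bar>a\<bar> \<le> 1" and "sum_mset M = 0"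
proof -
  obtain as where as: "char_poly A = (\<Prod>a\<leftarrow>as. [:- a, 1:])" "length as = n"
    using char_poly_factorized[OF A] by blast
  have ev: "eigenvalue A a" if "a \<in> set as" for a
    unfolding eigenvalue_root_char_poly[OF A] as(1) using that
    by (simp add: poly_prod_list prod_list_zero_iff image_iff o_def)
  have real: "complex_of_real (Re a) = a" if "a \<in> set as" for a
    by (rule of_real_Re[OF hermitian_eigenvalue_real[OF A h ev[OF that]]])
  define M where "M = mset (map Re as)"
  have "map_poly of_real (root_poly (mset (map Re bs))) = (\<Prod>a\<leftarrow>bs. [:- a, 1:])"
    if "set bs \<subseteq> set as" for bs
    using that
  proof (induction bs)
    case (Cons a bs)
    have "mset (map Re (a # bs)) = add_mset (Re a) (mset (map Re bs))" by simp
    with Cons real[of a] show ?case by (simp only: map_poly_root_poly_add) simp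
  qed simp
  then have "map_poly of_real (root_poly M) = char_poly A" unfolding as(1) M_def by blast
  also have "\<dots> = map_poly of_real (real_principal_char_poly A {0..<n})"
    using map_poly_real_principal_char_poly[OF A h, of "{0..<n}"] principal_char_poly_full[OF A] by simp
  finally have 1: "root_poly M = real_principal_char_poly A {0..<n}"
    by (rule of_real_poly_hom.injectivity)
  have 2: "\<forall>a\<in>#M. \<bar>a\<bar> \<le> 1"
  proof
    fix a assume "a \<in># M"
    then obtain z where "z \<in> set as" "a = Re z" unfolding M_def by auto
    then show "\<bar>a\<bar> \<le> 1" using eigenvalue_le_op_norm[OF A ev] op abs_Re_le_cmod[of z] by force
  qed
  have "sum_mset M = Re (sum_list as)" unfolding M_def by (induction as) simp_all
  then have 3: "sum_mset M = 0" using mat_trace_eq_sum_roots[OF A as(1)] tr by simp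
  show thesis using that[OF 1[symmetric] _ 2 3] as(2) unfolding M_def by simp
qed

text \<open>An eigenvector of the submatrix, extended by zero, lies in the kernel of
  \<open>principal_char_mat A T\<close> evaluated at \<open>k\<close>, whose determinant is the
  value of the polynomial.\<close>

lemma eigenvalue_submatrix_root:
  assumes A: "A \<in> carrier_mat n n" and T: "T \<subseteq> {0..<n}" and e: "eigenvalue (submatrix A T T) k"
  shows "poly (principal_char_poly A T) k = 0"
proof -
  let ?m = "card T"
  have fin: "finite T" using T finite_subset by blast
  have card: "card {i. i < n \<and> i \<in> T} = ?m" using T by (intro arg_cong[of _ _ card]) auto
  have B: "submatrix A T T \<in> carrier_mat ?m ?m"
    using A card by (intro carrier_matI) (simp_all add: dim_submatrix)
  obtain w where w: "w \<in> carrier_vec ?m" "w \<noteq> 0\<^sub>v ?m" "submatrix A T T *\<^sub>v w = k \<cdot>\<^sub>v w"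
    using e B unfolding eigenvalue_def eigenvector_def by auto
  \<comment> \<open>\<open>submatrix\<close> numbers the elements of \<open>T\<close> through
    \<open>pick T\<close>; \<open>r\<close> is the inverse numbering.\<close>
  define r where "r c = card {x \<in> T. x < c}" for c
  have pick_T: "pick T i \<in> T" and r_pick: "r (pick T i) = i" if "i < ?m" for i
    using that pick_in_set_le card_pick_le unfolding r_def by auto
  have pick_r: "pick T (r a) = a" if "a \<in> T" for a unfolding r_def using that by (rule pick_card_in_set)
  have r_less: "r a < ?m" if "a \<in> T" for a
    unfolding r_def using that fin by (intro psubset_card_mono) auto
  have bij: "bij_betw (pick T) {0..<?m} T"
    by (rule bij_betw_byWitness[of _ r]) (use pick_T r_pick pick_r r_less in auto)
  define v where "v = vec n (\<lambda>c. if c \<in> T then w $ r c else 0)"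
  have v: "v \<in> carrier_vec n" unfolding v_def by simp
  have v_pick: "v $ pick T i = w $ i" if "i < ?m" for i
    unfolding v_def using that pick_T[OF that] r_pick[OF that] T by (simp add: subset_iff)
  have "v \<noteq> 0\<^sub>v n"
  proof
    assume "v = 0\<^sub>v n"
    then have "w $ i = 0" if "i < ?m" for i
      using v_pick[OF that] pick_T[OF that] T by (simp add: subset_iff)
    then have "w = 0\<^sub>v ?m" using w(1) by (intro eq_vecI) auto
    then show False using w(2) by contradiction
  qed
  moreover
  define K where "K = mat n n (\<lambda>(a, d). poly (principal_char_mat A T $$ (a, d)) k)"
  have K: "K \<in> carrier_mat n n" unfolding K_def by simp
  have "K *\<^sub>v v = 0\<^sub>v n"
  proof (rule eq_vecI)
    fix a assume "a < dim_vec (0\<^sub>v n :: complex vec)"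
    then have a: "a < n" by simp
    have "(K *\<^sub>v v) $ a = (if a \<in> T then (k + 0) * v $ a - (\<Sum>d\<in>T. A $$ (a, d) * v $ d) else 0)"
      by (rule principal_kernel_vec[OF A T v K _ _ a]) (auto simp: K_def v_def)
    moreover have "(\<Sum>d\<in>T. A $$ (a, d) * v $ d) = k * v $ a" if aT: "a \<in> T"
    proof -
      have "(\<Sum>d\<in>T. A $$ (a, d) * v $ d) = (\<Sum>i\<in>{0..<?m}. A $$ (a, pick T i) * v $ pick T i)"
        by (rule sum.reindex_bij_betw[OF bij, symmetric])
      also have "\<dots> = (\<Sum>i\<in>{0..<?m}. submatrix A T T $$ (r a, i) * w $ i)"
        using A card r_less[OF aT] pick_r[OF aT]
        by (intro sum.cong refl) (simp add: submatrix_index v_pick)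
      also have "\<dots> = (submatrix A T T *\<^sub>v w) $ r a"
        using B w(1) r_less[OF aT] by (auto simp: scalar_prod_def intro!: sum.cong)
      also have "\<dots> = k * v $ a"
        unfolding w(3) using w(1) r_less[OF aT] v_pick[OF r_less[OF aT]] pick_r[OF aT] by simp
      finally show ?thesis .
    qed
    ultimately show "(K *\<^sub>v v) $ a = 0\<^sub>v n $ a" using a by simp
  qed (use K in simp)
  ultimately have "det K = 0" using det_0_iff_vec_prod_zero[OF K] v by blast
  moreover have "poly (principal_char_poly A T) k = det K"
    unfolding principal_char_poly_def
    by (rule poly_det_cong[OF K principal_char_mat_carrier[OF A]]) (simp add: K_def)
  ultimately show ?thesis by simp
qed

lemma hermitian_submatrix:
  assumes A: "A \<in> carrier_mat n n" and h: "hermitian_mat A" and T: "T \<subseteq> {0..<n}"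
  shows "submatrix A T T \<in> carrier_mat (card T) (card T)" and "hermitian_mat (submatrix A T T)"
proof -
  have card: "card {i. i < n \<and> i \<in> T} = card T" using T by (intro arg_cong[of _ _ card]) auto
  show B: "submatrix A T T \<in> carrier_mat (card T) (card T)"
    using A card by (intro carrier_matI) (simp_all add: dim_submatrix)
  have pick: "pick T i < n" if "i < card T" for i using pick_in_set_le[OF that] T by auto
  show "hermitian_mat (submatrix A T T)"
    unfolding hermitian_mat_iff[OF B]
  proof (intro allI impI)
    fix i j assume ij: "i < card T" "j < card T"
    have "A $$ (pick T i, pick T j) = cnj (A $$ (pick T j, pick T i))"
      using h pick[OF ij(1)] pick[OF ij(2)] unfolding hermitian_mat_iff[OF A] by blast
    moreover have "submatrix A T T $$ (i, j) = A $$ (pick T i, pick T j)"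
      "submatrix A T T $$ (j, i) = A $$ (pick T j, pick T i)"
      using A card ij by (simp_all add: submatrix_index)
    ultimately show "submatrix A T T $$ (i, j) = cnj (submatrix A T T $$ (j, i))"
      by (simp only:)
  qed
qed

section \<open>Bounding \<open>lambda_max\<close> on the retained indices\<close>

theorem theorem1p5:
  fixes A :: "complex mat" and n :: nat and c :: real
  assumes "n \<ge> 1"
    and "A \<in> carrier_mat n n"
    and "hermitian_mat A"
    and "mat_op_norm A \<le> 1"
    and "mat_trace A = 0"
    and "1 / 2 \<le> c" and "c < 1"
    and "c * real n \<in> \<int>"
  shows "\<exists>\<sigma>. \<sigma> \<subseteq> {0..<n} \<and> real (card \<sigma>) = c * real n
           \<and> lambda_max (remove_indices A \<sigma>) \<le> 2 * sqrt (c - c\<^sup>2)"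
proof -
  note A = assms(2) and h = assms(3)
  define b where "b = 2 * sqrt (c - c\<^sup>2)"
  obtain k' where k': "c * real n = of_int k'" using assms(8) by (rule Ints_cases)
  have "c * real n \<ge> 0" using assms(6) by simp
  then have "k' \<ge> 0" using k' by simp
  define k where "k = nat k'"
  have k: "real k = c * real n" using k' \<open>k' \<ge> 0\<close> unfolding k_def by simp
  have n: "real n > 0" using assms(1) by simp
  have "real k < real n" unfolding k using assms(7) n by simp
  then have kn: "k < n" by simp
  have "real n \<le> 2 * real k" unfolding k using mult_right_mono[OF assms(6), of "real n"] by simp
  then have nk: "n \<le> 2 * k" by linarith
  have cc: "c - c\<^sup>2 \<ge> 0" using assms(6,7) mult_left_mono[of c 1 c] by (simp add: power2_eq_square)
  then have b: "0 \<le> b" "b\<^sup>2 = 4 * (c - c\<^sup>2)" unfolding b_def by (simp_all add: power_mult_distrib)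
  obtain M where M: "real_principal_char_poly A {0..<n} = root_poly M" "size M = n"
      "\<forall>a\<in>#M. \<bar>a\<bar> \<le> 1" "sum_mset M = 0"
    using real_char_poly_eq_root_poly[OF A h assms(4,5)] by blast
  \<comment> \<open>The two sides are in fact equal, since \<open>k = c n\<close> and
    \<open>b^2 = 4 (c - c^2)\<close>.\<close>
  have "4 * real k * (real n - real k) \<le> b\<^sup>2 * (real n)\<^sup>2"
    unfolding b(2) k by (simp add: power2_eq_square algebra_simps)
  then have "\<forall>x>b. poly ((pderiv ^^ k) (root_poly M)) x > 0"
    using higher_pderiv_root_poly_pos[OF M(3,4) _ _ b(1), of k] nk kn M(2) by simp
  \<comment> \<open>\<open>T\<close> is the set of retained indices; deleting \<open>k\<close>
    indices uses up all \<open>k\<close> derivatives.\<close>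
  then obtain T where T: "T \<subseteq> {0..<n}" "card T = n - k"
      "\<forall>x>b. poly (real_principal_char_poly A T) x > 0"
    using exists_principal_char_poly_pos[OF A h, of "{0..<n}" k b] kn M(1) by auto
  define \<sigma> where "\<sigma> = {0..<n} - T"
  have "card \<sigma> = n - card T" unfolding \<sigma>_def using T(1) by (simp add: card_Diff_subset finite_subset)
  then have "card \<sigma> = k" using T(2) kn by simp
  have rem: "remove_indices A \<sigma> = submatrix A T T"
  proof -
    have "{0..<n} - \<sigma> = T" unfolding \<sigma>_def using T(1) by auto
    then show ?thesis using A unfolding remove_indices_def by simp
  qed
  let ?l = "lambda_max (submatrix A T T)"
  \<comment> \<open>As \<open>k < n\<close>, the submatrix has positive dimension and its largest
    eigenvalue exists; it is a root of a polynomial that is positive beyond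
    \<open>b\<close>.\<close>
  have "eigenvalue (submatrix A T T) (complex_of_real ?l)"
    using T(2) kn by (intro lambda_max_hermitian(3)[OF hermitian_submatrix[OF A h T(1)]]) simp
  then have "poly (map_poly of_real (real_principal_char_poly A T)) (complex_of_real ?l) = 0"
    unfolding map_poly_real_principal_char_poly[OF A h T(1)] by (rule eigenvalue_submatrix_root[OF A T(1)])
  then have "poly (real_principal_char_poly A T) ?l = 0" by (simp add: of_real_hom.poly_map_poly)
  then have "?l \<le> b" using T(3) by (metis less_irrefl not_le)
  then show ?thesis
    using \<open>card \<sigma> = k\<close> k rem unfolding b_def by (intro exI[of _ \<sigma>]) (auto simp: \<sigma>_def)
qed

end
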